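(* Let $(M,g)$ be an oriented $n$-dimensional Riemannian manifold with Hodge star $\star$. For every $Q\in\Omega^q(TM)$ and $\alpha\in\Omega^l(T^*M)$: (1) $\star(Q\lrcorner\alpha)=(-1)^{q(l-q)}\,Q^\flat\wedge\star\alpha$; (2) $\star(Q\lrcorner\star\alpha)=(-1)^{q(n-l-q)+l(n-l)}\,Q^\flat\wedge\alpha$; (3) $Q\lrcorner\alpha=(-1)^{(l-q)(n-l)}\star(Q^\flat\wedge\star\alpha)$; (4) $Q\lrcorner\star\alpha=(-1)^{lq}\star(Q^\flat\wedge\alpha)$.
   Context: $\Omega^q(TM)$ denotes smooth $q$-multivector fields (sections of $\Lambda^qTM$) and $\Omega^l(T^*M)$ smooth differential $l$-forms. Contraction is $(X_1\wedge\cdots\wedge X_q)\lrcorner\phi=X_q\lrcorner\cdots\lrcorner X_1\lrcorner\phi$, extended linearly (with $f\lrcorner\phi=f\phi$ for functions), and $Q\lrcorner\phi=0$ when the degree of $Q$ exceeds that of $\phi$. The metric $g$ is extended to multivector fields and to forms in the standard way ($g(v_1\wedge\cdots\wedge v_j,w_1\wedge\cdots\wedge w_j)=\det(g(v_a,w_b))$). The map $\flat:\Omega^j(TM)\to\Omega^j(T^*M)$, $Q\mapsto Q^\flat$, is the induced metric isomorphism, so that $(X_1\wedge\cdots\wedge X_j)^\flat=X_1^\flat\wedge\cdots\wedge X_j^\flat$ with $X^\flat=g(X,\cdot)$, and $g(Q,Q)=Q^\flat(Q)=g(Q^\flat,Q^\flat)$. The Hodge star is defined by $\beta\wedge\star\alpha=g(\beta,\alpha)\mathrm{Vol}_M$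 for $\alpha,\beta\in\Omega^l(T^*M)$. *)

theory Defs
  imports
    "HOL-Analysis.Analysis"
    "HOL-Library.Function_Algebras"
    "Jordan_Normal_Form.Determinant"
begin

section \<open>Pointwise vector space structure on functions\<close>

instantiation "fun" :: (type, real_vector) real_vector
begin

definition scaleR_fun :: "real \<Rightarrow> ('a \<Rightarrow> 'b) \<Rightarrow> 'a \<Rightarrow> 'b"
  where "scaleR_fun c f = (\<lambda>x. c *\<^sub>R f x)"

instance
  by standard (auto simp: scaleR_fun_def fun_eq_iff scaleR_add_right scaleR_add_left)

end

section \<open>Exterior algebra of a finite-dimensional subspace V\<close>

text \<open>
  An alternating \<open>l\<close>-form on \<open>V\<close> takes a list of \<open>l\<close> vectors of \<open>V\<close>. To make equality of forms
  meaningful, it is \<open>0\<close> on all other lists. In particular, a \<open>0\<close>-form is a number, the value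
  at the empty list.
\<close>

definition alt_forms :: "'v::real_vector set \<Rightarrow> nat \<Rightarrow> ('v list \<Rightarrow> real) set" where
  "alt_forms V l = {\<omega>.
     (\<forall>xs. \<not> (length xs = l \<and> set xs \<subseteq> V) \<longrightarrow> \<omega> xs = 0) \<and>
     (\<forall>xs i x y a b. length xs = l \<and> set xs \<subseteq> V \<and> i < l \<and> x \<in> V \<and> y \<in> V \<longrightarrow>
        \<omega> (xs[i := a *\<^sub>R x + b *\<^sub>R y]) = a * \<omega> (xs[i := x]) + b * \<omega> (xs[i := y])) \<and>
     (\<forall>xs. length xs = l \<and> set xs \<subseteq> V \<and> \<not> distinct xs \<longrightarrow> \<omega> xs = 0)}"

text \<open>
  \<open>q\<close>-vectors are the alternating \<open>q\<close>-forms on the dual space, which consists of the \<open>1\<close>-forms;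
  \<open>vector_as_multivector V X\<close> is the element of \<open>\<Lambda>\<^sup>1 V\<close> given by evaluation at \<open>X \<in> V\<close>.
\<close>

definition multivectors ::
  "'v::real_vector set \<Rightarrow> nat \<Rightarrow> (('v list \<Rightarrow> real) list \<Rightarrow> real) set" where
  "multivectors V q = alt_forms (alt_forms V 1) q"

definition vector_as_multivector ::
  "'v::real_vector set \<Rightarrow> 'v \<Rightarrow> ('v list \<Rightarrow> real) list \<Rightarrow> real" where
  "vector_as_multivector V X =
     (\<lambda>\<theta>s. if length \<theta>s = 1 \<and> set \<theta>s \<subseteq> alt_forms V 1 then hd \<theta>s [X] else 0)"

text \<open>
  The factor \<open>1 / (k! l!)\<close> is the one for which
  \<open>(\<theta>\<^sub>1 \<and> \<dots> \<and> \<theta>\<^sub>l) (X\<^sub>1, \<dots>, X\<^sub>l) = det (\<theta>\<^sub>a (X\<^sub>b))\<close>.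
\<close>

definition wedge ::
  "nat \<Rightarrow> nat \<Rightarrow> ('v list \<Rightarrow> real) \<Rightarrow> ('v list \<Rightarrow> real) \<Rightarrow> 'v list \<Rightarrow> real" where
  "wedge k l \<alpha> \<beta> = (\<lambda>xs. if length xs = k + l
     then (\<Sum>\<pi> | \<pi> permutes {..<k + l}. of_int (sign \<pi>) *
             \<alpha> (map (\<lambda>i. xs ! \<pi> i) [0..<k]) * \<beta> (map (\<lambda>i. xs ! \<pi> i) [k..<k + l]))
          / (fact k * fact l)
     else 0)"

fun wedge_list :: "('v list \<Rightarrow> real) list \<Rightarrow> 'v list \<Rightarrow> real" where
  "wedge_list [] = (\<lambda>xs. if xs = [] then 1 else 0)"
| "wedge_list (\<theta> # \<theta>s) = wedge 1 (length \<theta>s) \<theta> (wedge_list \<theta>s)"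

definition decomposable ::
  "'v::real_vector set \<Rightarrow> 'v list \<Rightarrow> ('v list \<Rightarrow> real) list \<Rightarrow> real" where
  "decomposable V Xs = wedge_list (map (vector_as_multivector V) Xs)"

text \<open>
  The linear map \<open>F\<close> on \<open>\<Lambda>\<^sup>q V\<close> with \<open>F (X\<^sub>1 \<and> \<dots> \<and> X\<^sub>q) = f [X\<^sub>1, \<dots>, X\<^sub>q]\<close>. For finite-dimensional
  \<open>V\<close> and \<open>f\<close> alternating and multilinear on \<open>V\<close> it exists, and it is unique on
  \<open>multivectors V q\<close>; only its values off this subspace are an arbitrary choice.
\<close>

definition linear_extension ::
  "'v::real_vector set \<Rightarrow> nat \<Rightarrow> ('v list \<Rightarrow> 'w::real_vector) \<Rightarrow>
   (('v list \<Rightarrow> real) list \<Rightarrow> real) \<Rightarrow> 'w" where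
  "linear_extension V q f = (SOME F. linear F \<and>
     (\<forall>Xs. length Xs = q \<and> set Xs \<subseteq> V \<longrightarrow> F (decomposable V Xs) = f Xs))"

definition interior :: "'v \<Rightarrow> ('v list \<Rightarrow> real) \<Rightarrow> 'v list \<Rightarrow> real" where
  "interior X \<phi> = (\<lambda>Ys. \<phi> (X # Ys))"

text \<open>
  Since \<open>fold\<close> applies the head of the list first, \<open>fold interior [X\<^sub>1, \<dots>, X\<^sub>q] \<phi>\<close> contracts
  first with \<open>X\<^sub>1\<close> and last with \<open>X\<^sub>q\<close>. It is \<open>0\<close> if \<open>q\<close> exceeds the degree of \<open>\<phi>\<close>, because
  then \<open>\<phi>\<close> is only ever evaluated at lists that are too long.
\<close>

definition contract ::
  "'v::real_vector set \<Rightarrow> nat \<Rightarrow> (('v list \<Rightarrow> real) list \<Rightarrow> real) \<Rightarrow>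
   ('v list \<Rightarrow> real) \<Rightarrow> 'v list \<Rightarrow> real" where
  "contract V q Q \<phi> = linear_extension V q (\<lambda>Xs. fold interior Xs \<phi>) Q"

definition flat_vector ::
  "'v::real_vector set \<Rightarrow> ('v \<Rightarrow> 'v \<Rightarrow> real) \<Rightarrow> 'v \<Rightarrow> 'v list \<Rightarrow> real" where
  "flat_vector V g X = (\<lambda>ys. if length ys = 1 \<and> set ys \<subseteq> V then g X (hd ys) else 0)"

definition flat ::
  "'v::real_vector set \<Rightarrow> ('v \<Rightarrow> 'v \<Rightarrow> real) \<Rightarrow> nat \<Rightarrow>
   (('v list \<Rightarrow> real) list \<Rightarrow> real) \<Rightarrow> 'v list \<Rightarrow> real" where
  "flat V g q = linear_extension V q (\<lambda>Xs. wedge_list (map (flat_vector V g) Xs))"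

text \<open>
  The bilinear extension of
  \<open>g (\<theta>\<^sub>1 \<and> \<dots> \<and> \<theta>\<^sub>l, \<eta>\<^sub>1 \<and> \<dots> \<and> \<eta>\<^sub>l) = det (g (\<theta>\<^sub>a, \<eta>\<^sub>b))\<close>, where the covectors are written as
  \<open>\<theta>\<^sub>a = X\<^sub>a\<^sup>\<flat>\<close> and \<open>\<eta>\<^sub>b = Y\<^sub>b\<^sup>\<flat>\<close> and \<open>g (X\<^sup>\<flat>, Y\<^sup>\<flat>) = g (X, Y)\<close>. It is unique on \<open>alt_forms V l\<close>.
\<close>

definition form_metric ::
  "'v::real_vector set \<Rightarrow> ('v \<Rightarrow> 'v \<Rightarrow> real) \<Rightarrow> nat \<Rightarrow>
   ('v list \<Rightarrow> real) \<Rightarrow> ('v list \<Rightarrow> real) \<Rightarrow> real" where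
  "form_metric V g l = (SOME B. bilinear B \<and>
     (\<forall>Xs Ys. length Xs = l \<and> length Ys = l \<and> set Xs \<subseteq> V \<and> set Ys \<subseteq> V \<longrightarrow>
        B (wedge_list (map (flat_vector V g) Xs)) (wedge_list (map (flat_vector V g) Ys)) =
        Determinant.det (Matrix.mat l l (\<lambda>(a, b). g (Xs ! a) (Ys ! b)))))"

text \<open>\<open>P\<close> is the set of positively oriented ordered bases.\<close>

definition volume_form ::
  "'v::real_vector set \<Rightarrow> ('v \<Rightarrow> 'v \<Rightarrow> real) \<Rightarrow> 'v list set \<Rightarrow> nat \<Rightarrow> 'v list \<Rightarrow> real" where
  "volume_form V g P n = (THE \<omega>. \<omega> \<in> alt_forms V n \<and>
     (\<forall>Es\<in>P. (\<forall>i<n. \<forall>j<n. g (Es ! i) (Es ! j) = (if i = j then 1 else 0)) \<longrightarrow> \<omega> Es = 1))"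

text \<open>
  For \<open>l > n\<close> there is no degree \<open>n - l\<close> and the only \<open>l\<close>-form is \<open>0\<close>, so the star is set to \<open>0\<close>.
\<close>

definition star ::
  "'v::real_vector set \<Rightarrow> ('v \<Rightarrow> 'v \<Rightarrow> real) \<Rightarrow> 'v list set \<Rightarrow> nat \<Rightarrow> nat \<Rightarrow>
   ('v list \<Rightarrow> real) \<Rightarrow> 'v list \<Rightarrow> real" where
  "star V g P n l \<alpha> = (if l \<le> n
     then (THE \<gamma>. \<gamma> \<in> alt_forms V (n - l) \<and>
       (\<forall>\<beta>\<in>alt_forms V l.
          wedge l (n - l) \<beta> \<gamma> = form_metric V g l \<beta> \<alpha> *\<^sub>R volume_form V g P n))
     else 0)"

section \<open>Smooth manifolds\<close>

text \<open>\<open>C\<^sup>k\<close> and \<open>C\<^sup>\<infinity>\<close> functions on an open set \<open>S\<close>, via iterated directional derivatives.\<close>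

primrec Ck_on ::
  "nat \<Rightarrow> 'a::euclidean_space set \<Rightarrow> ('a \<Rightarrow> 'b::real_normed_vector) \<Rightarrow> bool" where
  "Ck_on 0 S f \<longleftrightarrow> continuous_on S f"
| "Ck_on (Suc k) S f \<longleftrightarrow> (\<forall>x\<in>S. f differentiable (at x)) \<and>
     (\<forall>v. Ck_on k S (\<lambda>x. frechet_derivative f (at x) v))"

definition smooth_on ::
  "'a::euclidean_space set \<Rightarrow> ('a \<Rightarrow> 'b::real_normed_vector) \<Rightarrow> bool" where
  "smooth_on S f \<longleftrightarrow> (\<forall>k. Ck_on k S f)"

text \<open>
  The manifold is a whole type \<open>'m\<close>, Hausdorff and second countable by its type classes. Its
  smooth structure is given by an atlas of charts \<open>(U, \<phi>)\<close> into \<open>'e\<close>, so its dimension is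
  \<open>DIM('e)\<close>.
\<close>

type_synonym ('m, 'e) chart = "'m set \<times> ('m \<Rightarrow> 'e)"

abbreviation chart_inv :: "('m, 'e) chart \<Rightarrow> 'e \<Rightarrow> 'm" where
  "chart_inv c \<equiv> inv_into (fst c) (snd c)"

definition smooth_atlas ::
  "('m::{t2_space, second_countable_topology}, 'e::euclidean_space) chart set \<Rightarrow> bool" where
  "smooth_atlas A \<longleftrightarrow>
     (\<Union>c\<in>A. fst c) = UNIV \<and>
     (\<forall>c\<in>A. open (fst c) \<and> open (snd c ` fst c) \<and>
        homeomorphism (fst c) (snd c ` fst c) (snd c) (chart_inv c)) \<and>
     (\<forall>c\<in>A. \<forall>d\<in>A. smooth_on (snd c ` (fst c \<inter> fst d)) (snd d \<circ> chart_inv c))"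

text \<open>
  A tangent vector at \<open>p\<close> is the family of its coordinate vectors in all the charts around \<open>p\<close>,
  related by the derivatives of the transition maps. Outside these charts it is set to \<open>0\<close>.
\<close>

type_synonym ('m, 'e) tvec = "('m, 'e) chart \<Rightarrow> 'e"

definition tangent_space ::
  "('m, 'e::euclidean_space) chart set \<Rightarrow> 'm \<Rightarrow> ('m, 'e) tvec set" where
  "tangent_space A p = {v.
     (\<forall>c\<in>A. \<forall>d\<in>A. p \<in> fst c \<and> p \<in> fst d \<longrightarrow>
        v d = frechet_derivative (snd d \<circ> chart_inv c) (at (snd c p)) (v c)) \<and>
     (\<forall>c. \<not> (c \<in> A \<and> p \<in> fst c) \<longrightarrow> v c = 0)}"

text \<open>
  The coordinate vector field \<open>\<partial>\<^sub>b\<close> and the coordinate form \<open>dx\<^sup>b\<close> of the chart \<open>c\<close> at \<open>p\<close>, for a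
  standard basis vector \<open>b\<close> of the model space.
\<close>

definition coord_vector ::
  "('m, 'e::euclidean_space) chart set \<Rightarrow> ('m, 'e) chart \<Rightarrow> 'm \<Rightarrow> 'e \<Rightarrow> ('m, 'e) tvec" where
  "coord_vector A c p b = (\<lambda>d. if d \<in> A \<and> p \<in> fst d
     then frechet_derivative (snd d \<circ> chart_inv c) (at (snd c p)) b else 0)"

definition coord_form ::
  "('m, 'e::euclidean_space) chart set \<Rightarrow> ('m, 'e) chart \<Rightarrow> 'm \<Rightarrow> 'e \<Rightarrow>
   ('m, 'e) tvec list \<Rightarrow> real" where
  "coord_form A c p b = (\<lambda>vs. if length vs = 1 \<and> set vs \<subseteq> tangent_space A p
     then inner (hd vs c) b else 0)"

type_synonym ('m, 'e) form_field = "'m \<Rightarrow> ('m, 'e) tvec list \<Rightarrow> real"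

type_synonym ('m, 'e) multivector_field = "'m \<Rightarrow> (('m, 'e) tvec list \<Rightarrow> real) list \<Rightarrow> real"

definition differential_forms ::
  "('m, 'e::euclidean_space) chart set \<Rightarrow> nat \<Rightarrow> ('m, 'e) form_field set" where
  "differential_forms A l = {\<alpha>.
     (\<forall>p. \<alpha> p \<in> alt_forms (tangent_space A p) l) \<and>
     (\<forall>c\<in>A. \<forall>bs. length bs = l \<and> set bs \<subseteq> Basis \<longrightarrow>
        smooth_on (snd c ` fst c)
          ((\<lambda>p. \<alpha> p (map (coord_vector A c p) bs)) \<circ> chart_inv c))}"

definition multivector_fields ::
  "('m, 'e::euclidean_space) chart set \<Rightarrow> nat \<Rightarrow> ('m, 'e) multivector_field set" where
  "multivector_fields A q = {Q.
     (\<forall>p. Q p \<in> multivectors (tangent_space A p) q) \<and>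
     (\<forall>c\<in>A. \<forall>bs. length bs = q \<and> set bs \<subseteq> Basis \<longrightarrow>
        smooth_on (snd c ` fst c)
          ((\<lambda>p. Q p (map (coord_form A c p) bs)) \<circ> chart_inv c))}"

section \<open>Oriented Riemannian manifolds\<close>

type_synonym ('m, 'e) metric = "'m \<Rightarrow> ('m, 'e) tvec \<Rightarrow> ('m, 'e) tvec \<Rightarrow> real"

definition riemannian_metric ::
  "('m, 'e::euclidean_space) chart set \<Rightarrow> ('m, 'e) metric \<Rightarrow> bool" where
  "riemannian_metric A g \<longleftrightarrow>
     (\<forall>p. \<forall>u\<in>tangent_space A p. \<forall>v\<in>tangent_space A p. \<forall>w\<in>tangent_space A p. \<forall>a b.
        g p u v = g p v u \<and>
        g p (a *\<^sub>R u + b *\<^sub>R v) w = a * g p u w + b * g p v w \<and>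
        (u \<noteq> 0 \<longrightarrow> g p u u > 0)) \<and>
     (\<forall>c\<in>A. \<forall>b\<in>Basis. \<forall>b'\<in>Basis.
        smooth_on (snd c ` fst c)
          ((\<lambda>p. g p (coord_vector A c p b) (coord_vector A c p b')) \<circ> chart_inv c))"

text \<open>
  An orientation selects the positive ordered bases of each tangent space, as those on which some
  nowhere vanishing smooth form of top degree is positive. That form is only determined up to a
  positive function and so is not part of the data.
\<close>

definition is_orientation ::
  "('m, 'e::euclidean_space) chart set \<Rightarrow> ('m \<Rightarrow> ('m, 'e) tvec list set) \<Rightarrow> bool" where
  "is_orientation A P \<longleftrightarrow> (\<exists>\<mu>\<in>differential_forms A DIM('e).
     \<forall>p. \<mu> p \<noteq> 0 \<and> P p = {Es. \<mu> p Es > 0})"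

definition oriented_riemannian_manifold ::
  "('m::{t2_space, second_countable_topology}, 'e::euclidean_space) chart set \<Rightarrow>
   ('m, 'e) metric \<Rightarrow> ('m \<Rightarrow> ('m, 'e) tvec list set) \<Rightarrow> bool" where
  "oriented_riemannian_manifold A g P \<longleftrightarrow>
     smooth_atlas A \<and> riemannian_metric A g \<and> is_orientation A P"

text \<open>
  The operations on fields are the pointwise ones. This includes the Hodge star, whose defining
  identity is linear over functions in both arguments.
\<close>

definition wedge_field ::
  "nat \<Rightarrow> nat \<Rightarrow> ('m, 'e) form_field \<Rightarrow> ('m, 'e) form_field \<Rightarrow> ('m, 'e) form_field" where
  "wedge_field k l \<alpha> \<beta> = (\<lambda>p. wedge k l (\<alpha> p) (\<beta> p))"

definition contract_field ::
  "('m, 'e::euclidean_space) chart set \<Rightarrow> nat \<Rightarrow> ('m, 'e) multivector_field \<Rightarrow>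
   ('m, 'e) form_field \<Rightarrow> ('m, 'e) form_field" where
  "contract_field A q Q \<alpha> = (\<lambda>p. contract (tangent_space A p) q (Q p) (\<alpha> p))"

definition flat_field ::
  "('m, 'e::euclidean_space) chart set \<Rightarrow> ('m, 'e) metric \<Rightarrow> nat \<Rightarrow>
   ('m, 'e) multivector_field \<Rightarrow> ('m, 'e) form_field" where
  "flat_field A g q Q = (\<lambda>p. flat (tangent_space A p) (g p) q (Q p))"

definition hodge_star ::
  "('m, 'e::euclidean_space) chart set \<Rightarrow> ('m, 'e) metric \<Rightarrow>
   ('m \<Rightarrow> ('m, 'e) tvec list set) \<Rightarrow> nat \<Rightarrow> ('m, 'e) form_field \<Rightarrow> ('m, 'e) form_field" where
  "hodge_star A g P l \<alpha> = (\<lambda>p. star (tangent_space A p) (g p) (P p) DIM('e) l (\<alpha> p))"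

end

theory Submission
  imports Defs "HOL-Combinatorics.Multiset_Permutations"
begin

text \<open>
  All operations are pointwise, so fix a tangent space and a positively oriented orthonormal basis
  \<open>e\<close>. Writing \<open>\<iota>\<^sub>\<beta> \<phi> = 1 / k! \<Sum>\<^sub>I \<beta>(e\<^sub>I) \<phi>(e\<^sub>I, \<dots>)\<close> for a \<open>k\<close>-form \<open>\<beta>\<close>, contraction with a multivector
  \<open>Q\<close> is \<open>\<iota>\<close> of \<open>Q\<^sup>\<flat>\<close>, and \<open>\<star>\<alpha> = \<iota>\<^sub>\<alpha> Vol\<close>. Since \<open>\<iota>\<^sub>\<beta> \<iota>\<^sub>\<alpha> = \<iota>\<close> of \<open>\<alpha> \<and> \<beta>\<close>, applying both sides to
  \<open>Vol\<close> and exchanging the factors of the wedge product gives (4). Replacing \<open>\<alpha>\<close> by \<open>\<star>\<alpha>\<close> in (4) and using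
  \<open>\<star>\<star> = (-1)\<close> to the power \<open>l (n - l)\<close> gives (3), and applying \<open>\<star>\<close> to (3) and (4) gives (1) and (2). The
  degenerate cases \<open>l > n\<close>, \<open>q > l\<close> and \<open>q + l > n\<close> hold because both sides vanish.
\<close>

section \<open>Alternating forms and the wedge product\<close>

text \<open>The operations are specified by choice and description operators, so most of the work
  lies in identifying each of them with an explicit formula; after that only composition rules for
  \<open>form_contract\<close> and the parity of exponents remain. Two obstacles shape this.
  Multivectors are forms on the dual space, and evaluating a linear extension from decomposables
  needs both existence and uniqueness. Both come from expanding a form in a basis, which is proved
  once, in a locale general enough to be used for the dual space too. The other obstacle is signs:
  sums run over all index lists instead of increasing ones and are divided by factorials. Such sums
  are invariant under permutations and split under concatenation, so shuffles never occur, and the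
  signs of rearrangements are read off as components of \<open>vol\<close>, which square to
  1.\<close>

lemma sum_fun_apply: "(\<Sum>i\<in>S. f i) x = (\<Sum>i\<in>S. f i x)"
  by (induction S rule: infinite_finite_induct) auto

lemma scaleR_fun_apply [simp]: "(c *\<^sub>R f) x = c *\<^sub>R f x"
  by (simp add: scaleR_fun_def)

lemma alt_formsI:
  assumes "\<And>xs. \<not> (length xs = l \<and> set xs \<subseteq> V) \<Longrightarrow> \<omega> xs = 0"
    and "\<And>xs i x y a b. length xs = l \<Longrightarrow> set xs \<subseteq> V \<Longrightarrow> i < l \<Longrightarrow> x \<in> V \<Longrightarrow> y \<in> V \<Longrightarrow>
      \<omega> (xs[i := a *\<^sub>R x + b *\<^sub>R y]) = a * \<omega> (xs[i := x]) + b * \<omega> (xs[i := y])"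
    and "\<And>xs. length xs = l \<Longrightarrow> set xs \<subseteq> V \<Longrightarrow> \<not> distinct xs \<Longrightarrow> \<omega> xs = 0"
  shows "\<omega> \<in> alt_forms V l"
  using assms unfolding alt_forms_def by auto

lemma alt_forms_outside:
  assumes "\<omega> \<in> alt_forms V l" "\<not> (length xs = l \<and> set xs \<subseteq> V)"
  shows "\<omega> xs = 0"
  using assms unfolding alt_forms_def by blast

lemma alt_forms_linear:
  assumes "\<omega> \<in> alt_forms V l" "length xs = l" "set xs \<subseteq> V" "i < l" "x \<in> V" "y \<in> V"
  shows "\<omega> (xs[i := a *\<^sub>R x + b *\<^sub>R y]) = a * \<omega> (xs[i := x]) + b * \<omega> (xs[i := y])"
  using assms unfolding alt_forms_def by blast

lemma alt_forms_not_distinct: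
  assumes "\<omega> \<in> alt_forms V l" "\<not> distinct xs"
  shows "\<omega> xs = 0"
  using assms unfolding alt_forms_def by blast

lemma subspace_alt_forms: "subspace (alt_forms V l)"
  unfolding subspace_def alt_forms_def by (auto simp: algebra_simps)

lemma zero_in_alt_forms [simp]: "0 \<in> alt_forms V l"
  by (simp add: subspace_0 subspace_alt_forms)

text \<open>Polarisation: the form vanishes when \<open>x + y\<close> stands in both slots, and of
  the four terms of the expansion only the two mixed ones survive.\<close>

lemma alt_forms_swap:
  assumes V: "subspace V" and \<omega>: "\<omega> \<in> alt_forms V l"
    and xs: "length xs = l" "set xs \<subseteq> V" and ij: "i < l" "j < l" "i \<noteq> j"
    and xy: "x \<in> V" "y \<in> V"
  shows "\<omega> (xs[i := x, j := y]) = - \<omega> (xs[i := y, j := x])"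
proof -
  have upd: "set (xs[k := u]) \<subseteq> V" if "u \<in> V" for k u
    using xs that by (meson set_update_subsetI)
  have 1: "\<omega> (xs[i := u, j := x + y]) = \<omega> (xs[i := u, j := x]) + \<omega> (xs[i := u, j := y])"
    if "u \<in> V" for u
    using alt_forms_linear[OF \<omega>, of "xs[i := u]" j x y 1 1] xs ij xy upd that by simp
  have 2: "\<omega> (xs[i := x + y, j := u]) = \<omega> (xs[i := x, j := u]) + \<omega> (xs[i := y, j := u])"
    if "u \<in> V" for u
    using alt_forms_linear[OF \<omega>, of "xs[j := u]" i x y 1 1] xs ij xy upd that
    by (simp add: list_update_swap)
  have 3: "\<omega> (xs[i := u, j := u]) = 0" for u
  proof (rule alt_forms_not_distinct[OF \<omega>])
    show "\<not> distinct (xs[i := u, j := u])"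
      unfolding distinct_conv_nth using ij xs
      by (intro notI, elim allE[of _ i] allE[of _ j]) (auto simp: nth_list_update)
  qed
  have "x + y \<in> V"
    using V xy by (simp add: subspace_add)
  then have "0 = \<omega> (xs[i := x, j := y]) + \<omega> (xs[i := y, j := x])"
    using 1[of "x + y"] 2[OF xy(1)] 2[OF xy(2)] 3[of x] 3[of y] 3[of "x + y"] by simp
  then show ?thesis
    by simp
qed

lemma permute_list_transpose:
  assumes "i < length xs" "j < length xs"
  shows "permute_list (Transposition.transpose i j) xs = xs[i := xs ! j, j := xs ! i]"
proof (rule nth_equalityI)
  fix k
  assume "k < length (permute_list (Transposition.transpose i j) xs)"
  then show "permute_list (Transposition.transpose i j) xs ! k = xs[i := xs ! j, j := xs ! i] ! k"
    using assms by (cases "k = i"; cases "k = j") (simp_all add: permute_list_def)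
qed simp

lemma alt_forms_permute:
  assumes V: "subspace V" and \<omega>: "\<omega> \<in> alt_forms V l" and \<pi>: "\<pi> permutes {..<length xs}"
  shows "\<omega> (permute_list \<pi> xs) = of_int (sign \<pi>) * \<omega> xs"
proof (cases "length xs = l \<and> set xs \<subseteq> V")
  case False
  then show ?thesis
    using alt_forms_outside[OF \<omega>] \<pi> by (metis length_permute_list mult_zero_right set_permute_list)
next
  case True
  from \<pi> have "\<pi> permutes {..<l}"
    using True by simp
  \<comment> \<open>The list is quantified inside the induction: composing with a transposition on
    the left transposes the list first, and the inductive hypothesis is then used at the transposed
    list.\<close>
  from this finite_lessThan have "\<forall>xs. length xs = l \<and> set xs \<subseteq> V \<longrightarrow>
      \<omega> (permute_list \<pi> xs) = of_int (sign \<pi>) * \<omega> xs"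
  proof (induction \<pi> rule: permutes_induct)
    case id
    then show ?case by simp
  next
    case (swap a b p)
    show ?case
    proof (intro allI impI)
      fix xs :: "'a list"
      assume xs: "length xs = l \<and> set xs \<subseteq> V"
      let ?t = "Transposition.transpose a b"
      have t: "?t permutes {..<length xs}"
        using swap xs by (intro permutes_swap_id) auto
      have mem: "xs ! a \<in> V" "xs ! b \<in> V"
        using xs swap by auto
      have "\<omega> (permute_list (?t \<circ> p) xs) = of_int (sign p) * \<omega> (permute_list ?t xs)"
        using swap xs t by (simp add: permute_list_compose)
      also have "\<omega> (permute_list ?t xs) = - \<omega> (xs[a := xs ! a, b := xs ! b])"
        using alt_forms_swap[OF V \<omega>, of xs a b "xs ! b" "xs ! a"] xs swap mem
        by (simp add: permute_list_transpose)
      finally show "\<omega> (permute_list (?t \<circ> p) xs) = of_int (sign (?t \<circ> p)) * \<omega> xs"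
        using swap by (simp del: comp_apply o_apply add: sign_compose permutation_swap_id
            permutes_imp_permutation[OF finite_lessThan] sign_swap_id)
    qed
  qed
  then show ?thesis
    using True by blast
qed

text \<open>If \<open>xs\<close> is too long or leaves \<open>V\<close>, the partial application is
  0, which is a form of any degree; so the truncated difference \<open>m - length xs\<close> is
  correct in all cases.\<close>

lemma alt_forms_prefix:
  assumes "\<phi> \<in> alt_forms V m"
  shows "(\<lambda>ys. \<phi> (xs @ ys)) \<in> alt_forms V (m - length xs)"
proof (cases "length xs \<le> m \<and> set xs \<subseteq> V")
  case False
  then have "(\<lambda>ys. \<phi> (xs @ ys)) = 0"
    by (intro ext) (auto intro!: alt_forms_outside[OF assms(1)])
  then show ?thesis by simp
next
  case True
  show ?thesis
  proof (rule alt_formsI)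
    fix ys :: "'a list" and i x y a b
    assume "length ys = m - length xs" "set ys \<subseteq> V" "i < m - length xs" "x \<in> V" "y \<in> V"
    then show "\<phi> (xs @ ys[i := a *\<^sub>R x + b *\<^sub>R y]) =
        a * \<phi> (xs @ ys[i := x]) + b * \<phi> (xs @ ys[i := y])"
      using alt_forms_linear[OF assms(1), of "xs @ ys" "length xs + i" x y a b] True
      by (simp add: list_update_append)
  next
    fix ys :: "'a list"
    assume "\<not> (length ys = m - length xs \<and> set ys \<subseteq> V)"
    then show "\<phi> (xs @ ys) = 0"
      using True by (intro alt_forms_outside[OF assms(1)]) auto
  next
    fix ys :: "'a list"
    assume "\<not> distinct ys"
    then show "\<phi> (xs @ ys) = 0"
      by (intro alt_forms_not_distinct[OF assms(1)]) auto
  qed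
qed

text \<open>The length test forces the value 0 when \<open>k + length ys\<close> differs from
  \<open>m\<close>, where \<phi> could be nonzero on lists \<open>xs\<close> of another length. With
  the tail frozen, results on forms apply to the leading arguments alone.\<close>

lemma alt_forms_suffix:
  assumes "\<phi> \<in> alt_forms V m"
  shows "(\<lambda>xs. if length xs = k then \<phi> (xs @ ys) else 0) \<in> alt_forms V k"
proof (cases "k + length ys = m \<and> set ys \<subseteq> V")
  case False
  then have "(\<lambda>xs. if length xs = k then \<phi> (xs @ ys) else 0) = 0"
    by (intro ext) (auto intro!: alt_forms_outside[OF assms(1)])
  then show ?thesis by (simp only: zero_in_alt_forms)
next
  case True
  show ?thesis
  proof (rule alt_formsI)
    fix xs :: "'a list" and i x y a b
    assume "length xs = k" "set xs \<subseteq> V" "i < k" "x \<in> V" "y \<in> V"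
    then show "(if length (xs[i := a *\<^sub>R x + b *\<^sub>R y]) = k then \<phi> (xs[i := a *\<^sub>R x + b *\<^sub>R y] @ ys) else 0) =
        a * (if length (xs[i := x]) = k then \<phi> (xs[i := x] @ ys) else 0)
        + b * (if length (xs[i := y]) = k then \<phi> (xs[i := y] @ ys) else 0)"
      using alt_forms_linear[OF assms(1), of "xs @ ys" i x y a b] True
      by (simp add: list_update_append)
  next
    fix xs :: "'a list"
    assume "\<not> (length xs = k \<and> set xs \<subseteq> V)"
    then show "(if length xs = k then \<phi> (xs @ ys) else 0) = 0"
      using True by (auto intro!: alt_forms_outside[OF assms(1)])
  next
    fix xs :: "'a list"
    assume "\<not> distinct xs"
    then show "(if length xs = k then \<phi> (xs @ ys) else 0) = 0"
      by (auto intro!: alt_forms_not_distinct[OF assms(1)])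
  qed
qed

lemma alt_forms_block_swap:
  assumes V: "subspace V" and \<omega>: "\<omega> \<in> alt_forms V m"
  shows "\<omega> (xs @ ys @ zs) = (-1) ^ (length xs * length ys) * \<omega> (ys @ xs @ zs)"
proof (cases "length (xs @ ys @ zs) = m \<and> set (xs @ ys @ zs) \<subseteq> V")
  case False
  then have "\<omega> (xs @ ys @ zs) = 0" "\<omega> (ys @ xs @ zs) = 0"
    by (intro alt_forms_outside[OF \<omega>]; auto)+
  then show ?thesis by simp
next
  case True
  have adj: "\<omega> (ps @ x # y # zs) = - \<omega> (ps @ y # x # zs)"
    if "length (ps @ x # y # zs) = m" "set (ps @ x # y # zs) \<subseteq> V" for ps x y zs
    using alt_forms_swap[OF V \<omega> that, of "length ps" "Suc (length ps)" x y] that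
    by (simp add: list_update_append)
  have one: "\<omega> (ps @ x # ys @ zs) = (-1) ^ length ys * \<omega> (ps @ ys @ x # zs)"
    if "length (ps @ x # ys @ zs) = m" "set (ps @ x # ys @ zs) \<subseteq> V" for ps x ys zs
    using that
  proof (induction ys arbitrary: ps)
    case (Cons y ys)
    show ?case
      using Cons.IH[of "ps @ [y]"] Cons.prems adj[of ps x y "ys @ zs"] by simp
  qed simp
  show ?thesis
    using True
  proof (induction xs arbitrary: zs)
    case (Cons x xs)
    \<comment> \<open>The inductive hypothesis exchanges only blocks at the front of the list, so
      \<open>x\<close> is moved behind \<open>xs\<close> and \<open>ys\<close> beforehand and back
      over \<open>xs\<close> afterwards; the two signs from crossing \<open>xs\<close>
      cancel.\<close>
    have "\<omega> ((x # xs) @ ys @ zs) = (-1) ^ (length xs) * \<omega> (xs @ x # ys @ zs)"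
      using one[of "[]" x xs "ys @ zs"] Cons.prems by simp
    also have "\<omega> (xs @ x # ys @ zs) = (-1) ^ length ys * \<omega> (xs @ ys @ x # zs)"
      using one[of xs x ys zs] Cons.prems by simp
    also have "\<omega> (xs @ ys @ x # zs) = (-1) ^ (length xs * length ys) * \<omega> (ys @ xs @ x # zs)"
      using Cons.IH[of "x # zs"] Cons.prems by simp
    also have "\<omega> (ys @ xs @ x # zs) = (-1) ^ length xs * \<omega> (ys @ x # xs @ zs)"
      using one[of ys x xs zs] Cons.prems by (simp add: ac_simps)
    finally have "\<omega> ((x # xs) @ ys @ zs) = (-1) ^ length xs * (-1) ^ length xs *
        ((-1) ^ length ys * (-1) ^ (length xs * length ys)) * \<omega> (ys @ x # xs @ zs)"
      by (simp only: mult_ac)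
    also have "(-1::real) ^ length xs * (-1) ^ length xs = 1"
      by (simp flip: power_mult_distrib)
    finally show ?case
      by (simp add: power_add)
  qed simp
qed

section \<open>Wedge products of forms\<close>

lemma wedge_eq:
  assumes "length xs = k + l"
  shows "wedge k l \<alpha> \<beta> xs =
    (\<Sum>\<pi> | \<pi> permutes {..<k + l}. of_int (sign \<pi>) *
       (\<alpha> (take k (permute_list \<pi> xs)) * \<beta> (drop k (permute_list \<pi> xs)))) / (fact k * fact l)"
  using assms
  by (simp add: wedge_def permute_list_def take_map drop_map take_upt mult.assoc)

lemma wedge_in_alt_forms:
  assumes V: "subspace V" and \<alpha>: "\<alpha> \<in> alt_forms V k" and \<beta>: "\<beta> \<in> alt_forms V l"
  shows "wedge k l \<alpha> \<beta> \<in> alt_forms V (k + l)"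
proof (rule alt_formsI)
  fix xs
  assume xs: "\<not> (length xs = k + l \<and> set xs \<subseteq> V)"
  show "wedge k l \<alpha> \<beta> xs = 0"
  proof (cases "length xs = k + l")
    case True
    have "\<alpha> (take k (permute_list \<pi> xs)) * \<beta> (drop k (permute_list \<pi> xs)) = 0"
      if \<pi>: "\<pi> permutes {..<k + l}" for \<pi>
    proof -
      have "set (take k (permute_list \<pi> xs)) \<union> set (drop k (permute_list \<pi> xs)) = set xs"
        using \<pi> True by (metis append_take_drop_id set_append set_permute_list)
      then have "\<not> set (take k (permute_list \<pi> xs)) \<subseteq> V \<or> \<not> set (drop k (permute_list \<pi> xs)) \<subseteq> V"
        using xs True by auto
      then show ?thesis
        using alt_forms_outside[OF \<alpha>, of "take k (permute_list \<pi> xs)"]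
          alt_forms_outside[OF \<beta>, of "drop k (permute_list \<pi> xs)"] by auto
    qed
    then show ?thesis
      unfolding wedge_eq[OF True] by (subst sum.neutral) auto
  qed (simp add: wedge_def)
next
  fix xs :: "'a list" and i x y a b
  assume xs: "length xs = k + l" "set xs \<subseteq> V" and i: "i < k + l" and xy: "x \<in> V" "y \<in> V"
  define f where "f z \<pi> = \<alpha> (take k (permute_list \<pi> (xs[i := z]))) * \<beta> (drop k (permute_list \<pi> (xs[i := z])))"
    for z \<pi>
  have f: "f (a *\<^sub>R x + b *\<^sub>R y) \<pi> = a * f x \<pi> + b * f y \<pi>" if \<pi>: "\<pi> permutes {..<k + l}" for \<pi>
  proof -
    \<comment> \<open>After permuting, entry \<open>i\<close> of \<open>xs\<close> sits at position
      \<open>j\<close>. It thus enters exactly one of the two factors of the summand, and linearity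
      of that factor suffices.\<close>
    define j where "j = inv_into UNIV \<pi> i"
    define zs where "zs = permute_list \<pi> xs"
    have j: "\<pi> j = i" "j < k + l"
      using \<pi> i permutes_in_image[OF permutes_inv[OF \<pi>], of i] unfolding j_def
      by (auto simp: permutes_inverses)
    have zs: "length zs = k + l" "set zs \<subseteq> V"
      using xs \<pi> by (auto simp: zs_def)
    have upd: "permute_list \<pi> (xs[i := z]) = zs[j := z]" for z
    proof (rule nth_equalityI)
      fix m
      assume "m < length (permute_list \<pi> (xs[i := z]))"
      then have "m < k + l" "\<pi> m < k + l"
        using xs permutes_in_image[OF \<pi>, of m] by auto
      then show "permute_list \<pi> (xs[i := z]) ! m = zs[j := z] ! m"
        using xs \<pi> i j permutes_inj[OF \<pi>, THEN injD, of m j]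
        by (auto simp: zs_def permute_list_nth nth_list_update)
    qed (simp add: zs_def)
    have tz: "length (take k zs) = k" "set (take k zs) \<subseteq> V"
      and dz: "length (drop k zs) = l" "set (drop k zs) \<subseteq> V"
      using zs set_take_subset[of k zs] set_drop_subset[of k zs] by auto
    show ?thesis
    proof (cases "j < k")
      case True
      then show ?thesis
        using alt_forms_linear[OF \<alpha> tz True xy, of a b]
        by (simp add: f_def upd take_update_swap algebra_simps)
    next
      case False
      then have "j - k < l"
        using j by simp
      then show ?thesis
        using False alt_forms_linear[OF \<beta> dz _ xy, of "j - k" a b]
        by (simp add: f_def upd drop_update_swap algebra_simps)
    qed
  qed
  have w: "wedge k l \<alpha> \<beta> (xs[i := z]) =
      (\<Sum>\<pi> | \<pi> permutes {..<k + l}. of_int (sign \<pi>) * f z \<pi>) / (fact k * fact l)" for z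
    using xs by (simp add: wedge_eq f_def)
  have "(\<Sum>\<pi> | \<pi> permutes {..<k + l}. of_int (sign \<pi>) * f (a *\<^sub>R x + b *\<^sub>R y) \<pi>) =
      (\<Sum>\<pi> | \<pi> permutes {..<k + l}. a * (of_int (sign \<pi>) * f x \<pi>) + b * (of_int (sign \<pi>) * f y \<pi>))"
    by (rule sum.cong) (simp_all add: f algebra_simps)
  then show "wedge k l \<alpha> \<beta> (xs[i := a *\<^sub>R x + b *\<^sub>R y]) =
      a * wedge k l \<alpha> \<beta> (xs[i := x]) + b * wedge k l \<alpha> \<beta> (xs[i := y])"
    by (simp add: w sum.distrib sum_distrib_left add_divide_distrib)
next
  fix xs :: "'a list"
  assume xs: "length xs = k + l" "\<not> distinct xs"
  then obtain i j where ij: "i < k + l" "j < k + l" "i \<noteq> j" "xs ! i = xs ! j"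
    by (auto simp: distinct_conv_nth)
  define t where "t = Transposition.transpose i j"
  have t: "t permutes {..<k + l}"
    using ij unfolding t_def by (intro permutes_swap_id) auto
  have tx: "permute_list t xs = xs"
    using ij xs unfolding t_def by (metis list_update_id permute_list_transpose)
  define h where "h \<pi> = \<alpha> (take k (permute_list \<pi> xs)) * \<beta> (drop k (permute_list \<pi> xs))" for \<pi>
  \<comment> \<open>Composing with the transposition \<open>t\<close> of two equal entries leaves
    every value of \<open>h\<close> unchanged and flips the sign, so the sum equals its own
    negative.\<close>
  have "(\<Sum>\<pi> | \<pi> permutes {..<k + l}. of_int (sign \<pi>) * h \<pi>) =
      (\<Sum>\<pi> | \<pi> permutes {..<k + l}. of_int (sign (t \<circ> \<pi>)) * h (t \<circ> \<pi>))"
    by (rule setum_permutations_compose_left[OF t])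
  also have "\<dots> = (\<Sum>\<pi> | \<pi> permutes {..<k + l}. - (of_int (sign \<pi>) * h \<pi>))"
  proof (rule sum.cong)
    fix \<pi>
    assume "\<pi> \<in> {\<pi>. \<pi> permutes {..<k + l}}"
    then have \<pi>: "\<pi> permutes {..<k + l}"
      by simp
    have "h (t \<circ> \<pi>) = h \<pi>"
      unfolding h_def using permute_list_compose[of \<pi> xs t] \<pi> xs tx by simp
    moreover have "sign (t \<circ> \<pi>) = - sign \<pi>"
      unfolding t_def using \<pi> ij
      by (simp add: sign_compose permutation_swap_id permutes_imp_permutation[OF finite_lessThan] sign_swap_id)
    ultimately show "of_int (sign (t \<circ> \<pi>)) * h (t \<circ> \<pi>) = - (of_int (sign \<pi>) * h \<pi>)"
      by simp
  qed simp
  finally show "wedge k l \<alpha> \<beta> xs = 0"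
    using xs by (simp add: wedge_eq h_def sum_negf)
qed

text \<open>The recursion yields a sum over pairs of a permutation \<pi> of all positions and a
  permutation \<tau> of the tail. Shifted by one, \<tau> becomes the permutation
  \<open>sh \<tau>\<close> fixing 0, and the pair contributes the term of \<pi> composed with
  \<open>sh \<tau>\<close>. For each \<tau> this is a right translation of the full sum, which is
  therefore counted once per \<tau>; the factorial in \<open>wedge\<close> removes this
  multiplicity.\<close>

lemma wedge_list_eq:
  assumes "length xs = length \<theta>s"
  shows "wedge_list \<theta>s xs = (\<Sum>\<pi> | \<pi> permutes {..<length \<theta>s}. of_int (sign \<pi>) *
    (\<Prod>j<length \<theta>s. (\<theta>s ! j) [xs ! \<pi> j]))"
  using assms
proof (induction \<theta>s arbitrary: xs)
  case (Cons \<theta> \<theta>s)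
  let ?l = "length \<theta>s" and ?P = "\<lambda>n. {\<pi>. \<pi> permutes {..<n::nat}}"
  define G where "G \<rho> = of_int (sign \<rho>) * (\<Prod>j<Suc ?l. ((\<theta> # \<theta>s) ! j) [xs ! \<rho> j])" for \<rho>
  define sh where "sh \<tau> = map_permutation {..<?l} Suc \<tau>" for \<tau>
  have sh: "sh \<tau> permutes {..<Suc ?l}" "sign (sh \<tau>) = sign \<tau>" "sh \<tau> 0 = 0"
    "\<And>j. j < ?l \<Longrightarrow> sh \<tau> (Suc j) = Suc (\<tau> j)" if \<tau>: "\<tau> permutes {..<?l}" for \<tau>
  proof -
    have "sh \<tau> permutes Suc ` {..<?l}"
      unfolding sh_def using \<tau> by (intro map_permutation_permutes) (auto simp: bij_betw_def)
    then show "sh \<tau> permutes {..<Suc ?l}" "sh \<tau> 0 = 0"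
      by (auto intro: permutes_subset simp: permutes_not_in)
    show "sign (sh \<tau>) = sign \<tau>"
      unfolding sh_def using \<tau> by (intro sign_map_permutation) auto
    show "sh \<tau> (Suc j) = Suc (\<tau> j)" if "j < ?l" for j
      unfolding sh_def using \<tau> that by (subst map_permutation_apply) auto
  qed
  have len: "length xs = 1 + ?l"
    using Cons.prems by simp
  have summand: "of_int (sign \<pi>) * (\<theta> (take 1 (permute_list \<pi> xs)) *
      wedge_list \<theta>s (drop 1 (permute_list \<pi> xs))) = (\<Sum>\<tau>\<in>?P ?l. G (\<pi> \<circ> sh \<tau>))"
    if \<pi>: "\<pi> permutes {..<1 + ?l}" for \<pi>
  proof -
    have 1: "take 1 (permute_list \<pi> xs) = [xs ! \<pi> 0]"
      using len by (simp add: permute_list_def take_map upt_conv_Cons del: upt_Suc)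
    have 2: "drop 1 (permute_list \<pi> xs) ! i = xs ! \<pi> (Suc i)" if "i < ?l" for i
      using len that \<pi> by (simp add: permute_list_nth)
    have "wedge_list \<theta>s (drop 1 (permute_list \<pi> xs)) =
      (\<Sum>\<tau>\<in>?P ?l. of_int (sign \<tau>) * (\<Prod>j<?l. (\<theta>s ! j) [xs ! \<pi> (Suc (\<tau> j))]))"
      using len permutes_in_image[of _ "{..<?l}"]
      by (subst Cons.IH) (auto intro!: sum.cong prod.cong simp: 2 simp del: drop_Suc nth_drop One_nat_def)
    then have "of_int (sign \<pi>) * (\<theta> (take 1 (permute_list \<pi> xs)) *
        wedge_list \<theta>s (drop 1 (permute_list \<pi> xs))) =
      (\<Sum>\<tau>\<in>?P ?l. of_int (sign \<pi>) * of_int (sign \<tau>) *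
         (\<theta> [xs ! \<pi> 0] * (\<Prod>j<?l. (\<theta>s ! j) [xs ! \<pi> (Suc (\<tau> j))])))"
      by (simp add: 1 sum_distrib_left mult_ac del: One_nat_def)
    also have "\<dots> = (\<Sum>\<tau>\<in>?P ?l. G (\<pi> \<circ> sh \<tau>))"
    proof (rule sum.cong)
      fix \<tau>
      assume "\<tau> \<in> ?P ?l"
      then have \<tau>: "\<tau> permutes {..<?l}"
        by simp
      have "sign (\<pi> \<circ> sh \<tau>) = sign \<pi> * sign \<tau>"
        using sh[OF \<tau>] \<pi> by (simp add: sign_compose permutes_imp_permutation[OF finite_lessThan])
      then show "of_int (sign \<pi>) * of_int (sign \<tau>) *
          (\<theta> [xs ! \<pi> 0] * (\<Prod>j<?l. (\<theta>s ! j) [xs ! \<pi> (Suc (\<tau> j))])) = G (\<pi> \<circ> sh \<tau>)"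
        unfolding G_def prod.lessThan_Suc_shift by (simp add: sh[OF \<tau>] del: prod.lessThan_Suc)
    qed simp
    finally show ?thesis .
  qed
  have "wedge_list (\<theta> # \<theta>s) xs =
      (\<Sum>\<pi>\<in>?P (1 + ?l). of_int (sign \<pi>) * (\<theta> (take 1 (permute_list \<pi> xs)) *
        wedge_list \<theta>s (drop 1 (permute_list \<pi> xs)))) / fact ?l"
    using wedge_eq[OF len, of \<theta> "wedge_list \<theta>s"] by simp
  also have "\<dots> = (\<Sum>\<pi>\<in>?P (1 + ?l). \<Sum>\<tau>\<in>?P ?l. G (\<pi> \<circ> sh \<tau>)) / fact ?l"
    by (intro arg_cong2[where f = "(/)"] sum.cong refl summand) simp
  also have "\<dots> = (\<Sum>\<tau>\<in>?P ?l. \<Sum>\<pi>\<in>?P (Suc ?l). G (\<pi> \<circ> sh \<tau>)) / fact ?l"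
    by (subst sum.swap) simp
  also have "\<dots> = (\<Sum>\<tau>\<in>?P ?l. \<Sum>\<pi>\<in>?P (Suc ?l). G \<pi>) / fact ?l"
    by (intro arg_cong2[where f = "(/)"] sum.cong refl sum_permutations_compose_right[symmetric]) (simp add: sh)
  also have "\<dots> = (\<Sum>\<pi>\<in>?P (Suc ?l). G \<pi>)"
    by (simp add: card_permutations)
  finally show ?case
    by (simp add: G_def)
qed simp

lemma wedge_list_in_alt_forms:
  assumes "subspace V" "set \<theta>s \<subseteq> alt_forms V 1"
  shows "wedge_list \<theta>s \<in> alt_forms V (length \<theta>s)"
  using assms(2)
proof (induction \<theta>s)
  case Nil
  show ?case
    by (rule alt_formsI) auto
next
  case (Cons \<theta> \<theta>s)
  then show ?case
    using wedge_in_alt_forms[OF assms(1), of \<theta> 1 "wedge_list \<theta>s" "length \<theta>s"] by simp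
qed

definition index_lists :: "nat \<Rightarrow> nat \<Rightarrow> nat list set" where
  "index_lists n l = {I. set I \<subseteq> {..<n} \<and> length I = l}"

lemma finite_index_lists [simp]: "finite (index_lists n l)"
  unfolding index_lists_def by (rule finite_lists_length_eq) simp

lemma index_lists_0 [simp]: "index_lists n 0 = {[]}"
  by (auto simp: index_lists_def)

lemma index_lists_nth: "I \<in> index_lists n l \<Longrightarrow> j < l \<Longrightarrow> I ! j < n"
  unfolding index_lists_def using nth_mem by blast

lemma sum_index_lists_append:
  fixes f :: "nat list \<Rightarrow> 'b::comm_monoid_add"
  shows "(\<Sum>K\<in>index_lists n (k + l). f K) =
    (\<Sum>I\<in>index_lists n k. \<Sum>J\<in>index_lists n l. f (I @ J))"
proof -
  have "(\<Sum>K\<in>index_lists n (k + l). f K) =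
      (\<Sum>(I, J)\<in>index_lists n k \<times> index_lists n l. f (I @ J))"
    by (rule sum.reindex_bij_witness[where i = "\<lambda>(I, J). I @ J" and j = "\<lambda>K. (take k K, drop k K)"])
      (auto simp: index_lists_def dest: in_set_takeD in_set_dropD)
  then show ?thesis
    by (simp add: sum.cartesian_product)
qed

lemma sum_index_lists_Suc:
  fixes f :: "nat list \<Rightarrow> 'b::comm_monoid_add"
  shows "(\<Sum>K\<in>index_lists n (Suc l). f K) = (\<Sum>i<n. \<Sum>J\<in>index_lists n l. f (i # J))"
proof -
  have "(\<Sum>I\<in>index_lists n 1. h I) = (\<Sum>i<n. h [i])" for h :: "nat list \<Rightarrow> 'b"
    by (rule sum.reindex_bij_witness[where i = "\<lambda>i. [i]" and j = hd])
      (auto simp: index_lists_def length_Suc_conv)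
  then show ?thesis
    using sum_index_lists_append[of f n 1 l] by simp
qed

lemma sum_index_lists_permute:
  fixes f :: "nat list \<Rightarrow> 'b::comm_monoid_add"
  assumes \<pi>: "\<pi> permutes {..<l}"
  shows "(\<Sum>K\<in>index_lists n l. f (permute_list \<pi> K)) = (\<Sum>K\<in>index_lists n l. f K)"
proof (rule sum.reindex_bij_witness[where i = "permute_list (inv_into UNIV \<pi>)" and j = "permute_list \<pi>"])
  have inv: "inv_into UNIV \<pi> permutes {..<l}"
    using \<pi> by (rule permutes_inv)
  fix K
  assume "K \<in> index_lists n l"
  then have K: "set K \<subseteq> {..<n}" "length K = l"
    by (auto simp: index_lists_def)
  show "permute_list (inv_into UNIV \<pi>) (permute_list \<pi> K) = K" "permute_list \<pi> (permute_list (inv_into UNIV \<pi>) K) = K"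
    using permute_list_compose[of "inv_into UNIV \<pi>" K \<pi>] permute_list_compose[of \<pi> K "inv_into UNIV \<pi>"] \<pi> inv K
    by (simp_all add: permutes_inv_o)
  show "permute_list \<pi> K \<in> index_lists n l" "permute_list (inv_into UNIV \<pi>) K \<in> index_lists n l"
    using \<pi> inv K by (simp_all add: index_lists_def)
qed simp

lemma alt_forms_sum_Cons:
  assumes V: "subspace V" and \<omega>: "\<omega> \<in> alt_forms V (Suc l)"
    and xs: "length xs = l" "set xs \<subseteq> V" and y: "\<And>i. i \<in> S \<Longrightarrow> y i \<in> V"
  shows "\<omega> ((\<Sum>i\<in>S. c i *\<^sub>R y i) # xs) = (\<Sum>i\<in>S. c i * \<omega> (y i # xs))"
proof -
  have lin: "\<omega> ((a *\<^sub>R u + b *\<^sub>R v) # xs) = a * \<omega> (u # xs) + b * \<omega> (v # xs)"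
    if "u \<in> V" "v \<in> V" for a b u v
    using alt_forms_linear[OF \<omega>, of "u # xs" 0 u v a b] that xs by simp
  have 0: "\<omega> (0 # xs) = 0"
    using lin[of 0 0 0 0] V by (simp add: subspace_0)
  show ?thesis
    using y
  proof (induction S rule: infinite_finite_induct)
    case (insert i S)
    have "(\<Sum>i\<in>S. c i *\<^sub>R y i) \<in> V"
      using V insert.prems by (auto intro!: subspace_sum subspace_scale)
    then show ?case
      using insert lin[of "y i" "\<Sum>i\<in>S. c i *\<^sub>R y i" "c i" 1] by simp
  qed (simp_all add: 0)
qed

section \<open>Forms in an orthonormal basis\<close>

text \<open>Completeness of the basis is the expansion formula instead of a spanning condition. In
  this form it can be verified both for Gram-Schmidt bases and for the dual space, whose carrier is
  a set of functions.\<close>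

locale orthonormal_basis =
  fixes V :: "'v::real_vector set" and g :: "'v \<Rightarrow> 'v \<Rightarrow> real" and e :: "nat \<Rightarrow> 'v" and n :: nat
  assumes subspace: "subspace V"
    and basis_in: "i < n \<Longrightarrow> e i \<in> V"
    and orthonormal: "i < n \<Longrightarrow> j < n \<Longrightarrow> g (e i) (e j) = (if i = j then 1 else 0)"
    and metric_linear: "u \<in> V \<Longrightarrow> v \<in> V \<Longrightarrow> w \<in> V \<Longrightarrow>
      g (a *\<^sub>R u + b *\<^sub>R v) w = a * g u w + b * g v w"
    and metric_sym: "u \<in> V \<Longrightarrow> v \<in> V \<Longrightarrow> g u v = g v u"
    and expansion: "x \<in> V \<Longrightarrow> x = (\<Sum>i<n. g x (e i) *\<^sub>R e i)"
begin

lemma index_lists_map: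
  assumes "I \<in> index_lists n l"
  shows "length (map e I) = l" "set (map e I) \<subseteq> V"
  using assms basis_in by (auto simp: index_lists_def)

lemma alt_form_expand:
  assumes "\<omega> \<in> alt_forms V l" "length xs = l" "set xs \<subseteq> V"
  shows "\<omega> xs = (\<Sum>I\<in>index_lists n l. (\<Prod>j<l. g (xs ! j) (e (I ! j))) * \<omega> (map e I))"
  using assms
proof (induction xs arbitrary: \<omega> l)
  case (Cons x xs)
  let ?l = "length xs"
  have l: "l = Suc ?l"
    using Cons.prems by simp
  have pre: "(\<lambda>ys. \<omega> (y # ys)) \<in> alt_forms V ?l" for y
    using alt_forms_prefix[OF Cons.prems(1), of "[y]"] l by simp
  have "\<omega> (x # xs) = \<omega> ((\<Sum>i<n. g x (e i) *\<^sub>R e i) # xs)"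
    using expansion[of x] Cons.prems by simp
  also have "\<dots> = (\<Sum>i<n. g x (e i) * \<omega> (e i # xs))"
    using Cons.prems l by (intro alt_forms_sum_Cons[OF subspace, of \<omega> ?l]) (auto simp: basis_in)
  also have "\<dots> = (\<Sum>i<n. g x (e i) *
      (\<Sum>I\<in>index_lists n ?l. (\<Prod>j<?l. g (xs ! j) (e (I ! j))) * \<omega> (e i # map e I)))"
    using Cons.IH[OF pre] Cons.prems by simp
  also have "\<dots> = (\<Sum>I\<in>index_lists n l. (\<Prod>j<l. g ((x # xs) ! j) (e (I ! j))) * \<omega> (map e I))"
    unfolding l sum_index_lists_Suc prod.lessThan_Suc_shift
    by (simp add: sum_distrib_left mult.assoc del: prod.lessThan_Suc)
  finally show ?case .
qed simp

lemma alt_forms_eqI: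
  assumes "\<omega> \<in> alt_forms V l" "\<eta> \<in> alt_forms V l"
    and "\<And>I. I \<in> index_lists n l \<Longrightarrow> distinct I \<Longrightarrow> \<omega> (map e I) = \<eta> (map e I)"
  shows "\<omega> = \<eta>"
proof
  fix xs
  have eq: "\<omega> (map e I) = \<eta> (map e I)" if "I \<in> index_lists n l" for I
  proof (cases "distinct I")
    case False
    then have "\<not> distinct (map e I)"
      by (simp add: distinct_map)
    then show ?thesis
      using alt_forms_not_distinct assms by metis
  qed (use that assms in blast)
  show "\<omega> xs = \<eta> xs"
  proof (cases "length xs = l \<and> set xs \<subseteq> V")
    case True
    then show ?thesis
      using alt_form_expand[OF assms(1), of xs] alt_form_expand[OF assms(2), of xs] eq by simp
  next
    case False
    then show ?thesis
      using alt_forms_outside[OF assms(1) False] alt_forms_outside[OF assms(2) False] by simp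
  qed
qed

text \<open>Pigeonhole: a list of more than \<open>n\<close> indices below \<open>n\<close> repeats
  one.\<close>

lemma alt_forms_above_dim:
  assumes "\<omega> \<in> alt_forms V l" "n < l"
  shows "\<omega> = 0"
proof (rule alt_forms_eqI[OF assms(1) zero_in_alt_forms])
  fix I
  assume "I \<in> index_lists n l" "distinct I"
  then have "l \<le> card {..<n}"
    using card_mono[OF finite_lessThan, of "set I" n] distinct_card[of I] by (simp add: index_lists_def)
  then show "\<omega> (map e I) = 0 (map e I)"
    using assms by simp
qed

section \<open>Wedges of covectors dual to vectors\<close>

lemma flat_vector_in_alt_forms:
  assumes "X \<in> V"
  shows "flat_vector V g X \<in> alt_forms V 1"
proof (rule alt_formsI)
  fix xs :: "'v list" and i :: nat and x y and a b :: real
  assume xs: "length xs = 1" "set xs \<subseteq> V" "i < 1" "x \<in> V" "y \<in> V"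
  then obtain z where z: "xs = [z]"
    by (auto simp: length_Suc_conv)
  have "a *\<^sub>R x + b *\<^sub>R y \<in> V"
    using xs subspace by (simp add: subspace_add subspace_scale)
  then show "flat_vector V g X (xs[i := a *\<^sub>R x + b *\<^sub>R y]) =
      a * flat_vector V g X (xs[i := x]) + b * flat_vector V g X (xs[i := y])"
    using xs z metric_linear[of x y X a b] metric_sym assms by (simp add: flat_vector_def)
next
  fix xs :: "'v list"
  assume "length xs = 1" "\<not> distinct xs"
  then show "flat_vector V g X xs = 0"
    by (auto simp: length_Suc_conv)
qed (auto simp: flat_vector_def)

lemma wedge_flat_in_alt_forms:
  assumes "set Xs \<subseteq> V"
  shows "wedge_list (map (flat_vector V g) Xs) \<in> alt_forms V (length Xs)"
  using wedge_list_in_alt_forms[OF subspace, of "map (flat_vector V g) Xs"]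
    flat_vector_in_alt_forms assms by (auto simp: image_subset_iff)

lemma wedge_flat_eq:
  assumes "length ys = length Xs" "set ys \<subseteq> V"
  shows "wedge_list (map (flat_vector V g) Xs) ys =
    (\<Sum>\<pi> | \<pi> permutes {..<length Xs}. of_int (sign \<pi>) * (\<Prod>j<length Xs. g (Xs ! j) (ys ! \<pi> j)))"
proof -
  have "ys ! \<pi> j \<in> V" if "\<pi> permutes {..<length Xs}" "j < length Xs" for \<pi> j
    using assms permutes_in_image[OF that(1), of j] that(2) by auto
  then show ?thesis
    using assms by (auto simp: wedge_list_eq flat_vector_def intro!: sum.cong prod.cong)
qed

text \<open>Invariance of a determinant under transposition, by reindexing with inverse
  permutations. It makes the wedge an alternating form in \<open>Xs\<close> for fixed
  \<open>ys\<close>, the condition under which \<open>linear_extension\<close> can be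
  evaluated.\<close>

lemma wedge_flat_commute:
  assumes "length ys = length Xs" "set ys \<subseteq> V" "set Xs \<subseteq> V"
  shows "wedge_list (map (flat_vector V g) Xs) ys = wedge_list (map (flat_vector V g) ys) Xs"
proof -
  have "(\<Prod>j<length Xs. g (Xs ! j) (ys ! \<pi> j)) = (\<Prod>j<length Xs. g (ys ! j) (Xs ! inv_into UNIV \<pi> j))"
    if \<pi>: "\<pi> permutes {..<length Xs}" for \<pi>
  proof -
    have inv: "inv_into UNIV \<pi> permutes {..<length Xs}"
      using \<pi> by (rule permutes_inv)
    have "(\<Prod>j<length Xs. g (Xs ! j) (ys ! \<pi> j)) =
        (\<Prod>j<length Xs. g (Xs ! inv_into UNIV \<pi> j) (ys ! \<pi> (inv_into UNIV \<pi> j)))"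
      using prod.permute[OF inv, of "\<lambda>j. g (Xs ! j) (ys ! \<pi> j)"] by (simp add: comp_def)
    also have "\<dots> = (\<Prod>j<length Xs. g (ys ! j) (Xs ! inv_into UNIV \<pi> j))"
      using \<pi> assms permutes_in_image[OF inv]
      by (intro prod.cong) (auto simp: permutes_inverses intro!: metric_sym)
    finally show ?thesis .
  qed
  then have "wedge_list (map (flat_vector V g) Xs) ys =
      (\<Sum>\<pi> | \<pi> permutes {..<length Xs}. of_int (sign (inv_into UNIV \<pi>)) *
        (\<Prod>j<length Xs. g (ys ! j) (Xs ! inv_into UNIV \<pi> j)))"
    using assms by (auto simp: wedge_flat_eq sign_inverse permutes_imp_permutation[OF finite_lessThan]
        intro!: sum.cong)
  also have "\<dots> = wedge_list (map (flat_vector V g) ys) Xs"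
    using assms by (simp add: wedge_flat_eq
        sum_permutations_inverse[of "\<lambda>\<pi>. of_int (sign \<pi>) * (\<Prod>j<length Xs. g (ys ! j) (Xs ! \<pi> j))"])
  finally show ?thesis .
qed

text \<open>By the determinant formula the right side is a signed sum over permutations of
  coordinate expansions of \<omega> at the permuted arguments. Each term gives the value at
  \<open>xs\<close> once its sign is absorbed, and the \<open>fact l\<close> equal terms cancel the
  denominator.\<close>

lemma alt_form_eq_sum_wedge:
  assumes \<omega>: "\<omega> \<in> alt_forms V l"
  shows "\<omega> = (\<Sum>I\<in>index_lists n l. (\<omega> (map e I) / fact l) *\<^sub>R
    wedge_list (map (flat_vector V g) (map e I)))"
proof
  fix xs
  let ?w = "\<lambda>I. wedge_list (map (flat_vector V g) (map e I))"
  show "\<omega> xs = (\<Sum>I\<in>index_lists n l. (\<omega> (map e I) / fact l) *\<^sub>R ?w I) xs"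
  proof (cases "length xs = l \<and> set xs \<subseteq> V")
    case False
    have "?w I xs = 0" if "I \<in> index_lists n l" for I
      using alt_forms_outside[OF wedge_flat_in_alt_forms, of "map e I" xs] index_lists_map[OF that] False
      by simp
    then show ?thesis
      using alt_forms_outside[OF \<omega> False] by (simp add: sum_fun_apply)
  next
    case True
    let ?P = "{\<pi>. \<pi> permutes {..<l}}"
    have "?w I xs = (\<Sum>\<pi>\<in>?P. of_int (sign \<pi>) * (\<Prod>j<l. g (permute_list \<pi> xs ! j) (e (I ! j))))"
      if I: "I \<in> index_lists n l" for I
    proof -
      have "g (e (I ! j)) (xs ! \<pi> j) = g (permute_list \<pi> xs ! j) (e (I ! j))"
        if "\<pi> permutes {..<l}" "j < l" for \<pi> j
      proof -
        have "I ! j < n"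
          using I that by (simp add: index_lists_nth)
        then show ?thesis
          using that True basis_in permutes_in_image[OF that(1), of j]
          by (auto simp: permute_list_nth intro!: metric_sym)
      qed
      then show ?thesis
        using True I index_lists_map[OF I] by (subst wedge_flat_eq) (auto intro!: sum.cong prod.cong)
    qed
    then have "(\<Sum>I\<in>index_lists n l. \<omega> (map e I) * ?w I xs) =
        (\<Sum>I\<in>index_lists n l. \<Sum>\<pi>\<in>?P. of_int (sign \<pi>) *
           ((\<Prod>j<l. g (permute_list \<pi> xs ! j) (e (I ! j))) * \<omega> (map e I)))"
      by (simp add: sum_distrib_left mult_ac)
    also have "\<dots> = (\<Sum>\<pi>\<in>?P. of_int (sign \<pi>) * (\<Sum>I\<in>index_lists n l.
           (\<Prod>j<l. g (permute_list \<pi> xs ! j) (e (I ! j))) * \<omega> (map e I)))"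
      by (subst sum.swap) (simp add: sum_distrib_left)
    also have "\<dots> = (\<Sum>\<pi>\<in>?P. of_int (sign \<pi>) * \<omega> (permute_list \<pi> xs))"
      using True by (intro sum.cong refl arg_cong2[where f = "(*)"] alt_form_expand[OF \<omega>, symmetric]) auto
    also have "\<dots> = (\<Sum>\<pi>\<in>?P. \<omega> xs)"
    proof (rule sum.cong)
      fix \<pi>
      assume "\<pi> \<in> ?P"
      then have "\<omega> (permute_list \<pi> xs) = of_int (sign \<pi>) * \<omega> xs"
        using True by (intro alt_forms_permute[OF subspace \<omega>]) simp
      then show "of_int (sign \<pi>) * \<omega> (permute_list \<pi> xs) = \<omega> xs"
        by (simp flip: mult.assoc of_int_mult)
    qed simp
    also have "\<dots> = fact l * \<omega> xs"
      by (simp add: card_permutations)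
    finally show ?thesis
      by (simp add: sum_fun_apply field_simps flip: sum_divide_distrib)
  qed
qed

end

section \<open>The musical isomorphism, contraction and the metric on forms\<close>

context orthonormal_basis
begin

section \<open>Covectors and multivectors in the dual basis\<close>

abbreviation dual_basis :: "nat \<Rightarrow> 'v list \<Rightarrow> real" where
  "dual_basis i \<equiv> flat_vector V g (e i)"

lemma flat_vector_apply [simp]: "y \<in> V \<Longrightarrow> flat_vector V g X [y] = g X y"
  by (simp add: flat_vector_def)

definition dual_metric :: "('v list \<Rightarrow> real) \<Rightarrow> ('v list \<Rightarrow> real) \<Rightarrow> real" where
  "dual_metric \<theta> \<eta> = (\<Sum>i<n. \<theta> [e i] * \<eta> [e i])"

lemma dual_metric_basis:
  assumes "i < n"
  shows "dual_metric \<theta> (dual_basis i) = \<theta> [e i]"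
proof -
  have "dual_metric \<theta> (dual_basis i) = (\<Sum>j<n. if j = i then \<theta> [e j] else 0)"
    unfolding dual_metric_def
    by (rule sum.cong) (use assms in \<open>auto simp: basis_in orthonormal\<close>)
  then show ?thesis
    using assms by simp
qed

text \<open>
  Multivectors are forms on the dual space, so all results on forms apply to them through this
  instance of the locale.
\<close>

lemma orthonormal_basis_dual: "orthonormal_basis (alt_forms V 1) dual_metric dual_basis n"
proof
  show "subspace (alt_forms V 1)"
    by (rule subspace_alt_forms)
  show "dual_basis i \<in> alt_forms V 1" if "i < n" for i
    using that basis_in flat_vector_in_alt_forms by blast
  show "dual_metric (dual_basis i) (dual_basis j) = (if i = j then 1 else 0)"
    if "i < n" "j < n" for i j
    using that by (subst dual_metric_basis) (simp_all add: basis_in orthonormal)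
  show "dual_metric (a *\<^sub>R u + b *\<^sub>R v) w = a * dual_metric u w + b * dual_metric v w" for a b u v w
    by (simp add: dual_metric_def sum.distrib sum_distrib_left algebra_simps)
  show "dual_metric u v = dual_metric v u" for u v
    by (simp add: dual_metric_def mult.commute)
  fix \<theta>
  assume \<theta>: "\<theta> \<in> alt_forms V 1"
  show "\<theta> = (\<Sum>i<n. dual_metric \<theta> (dual_basis i) *\<^sub>R dual_basis i)"
  proof (rule alt_forms_eqI[OF \<theta>])
    show "(\<Sum>i<n. dual_metric \<theta> (dual_basis i) *\<^sub>R dual_basis i) \<in> alt_forms V 1"
      by (intro subspace_sum subspace_scale subspace_alt_forms) (auto intro: basis_in flat_vector_in_alt_forms simp del: One_nat_def)
    fix I
    assume "I \<in> index_lists n 1"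
    then obtain k where k: "I = [k]" "k < n"
      by (auto simp: index_lists_def length_Suc_conv)
    have "(\<Sum>i<n. dual_metric \<theta> (dual_basis i) *\<^sub>R dual_basis i) (map e I) =
        (\<Sum>i<n. if i = k then \<theta> [e i] else 0)"
      unfolding sum_fun_apply
      by (rule sum.cong) (use k in \<open>auto simp: dual_metric_basis basis_in orthonormal\<close>)
    then show "\<theta> (map e I) = (\<Sum>i<n. dual_metric \<theta> (dual_basis i) *\<^sub>R dual_basis i) (map e I)"
      using k by simp
  qed
qed

text \<open>Evaluating a covector at \<open>X\<close> is taking its dual inner product with the
  metric dual of \<open>X\<close>. Hence evaluation at \<open>X\<close> is itself a flattened vector
  of the dual instance of the locale, and decomposable multivectors fall under the results on wedges
  of such covectors.\<close>

lemma vector_as_multivector_eq: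
  assumes "X \<in> V"
  shows "vector_as_multivector V X = flat_vector (alt_forms V 1) dual_metric (flat_vector V g X)"
proof
  fix \<theta>s
  have "\<theta> [X] = dual_metric (flat_vector V g X) \<theta>" if "\<theta> \<in> alt_forms V 1" for \<theta>
  proof -
    have "\<theta> [X] = \<theta> [\<Sum>i<n. g X (e i) *\<^sub>R e i]"
      using expansion[OF assms] by simp
    also have "\<dots> = (\<Sum>i<n. g X (e i) * \<theta> [e i])"
      using that by (intro alt_forms_sum_Cons[OF subspace, of \<theta> 0]) (auto simp: basis_in)
    also have "\<dots> = dual_metric (flat_vector V g X) \<theta>"
      by (simp add: dual_metric_def basis_in)
    finally show ?thesis .
  qed
  then show "vector_as_multivector V X \<theta>s =
      flat_vector (alt_forms V 1) dual_metric (flat_vector V g X) \<theta>s"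
    by (cases \<theta>s) (auto simp: vector_as_multivector_def flat_vector_def)
qed

lemma decomposable_eq:
  assumes "set Xs \<subseteq> V"
  shows "decomposable V Xs =
    wedge_list (map (flat_vector (alt_forms V 1) dual_metric) (map (flat_vector V g) Xs))"
  unfolding decomposable_def map_map
  by (intro arg_cong[where f = wedge_list] map_cong) (use assms vector_as_multivector_eq in auto)

text \<open>Both sides are the determinant of the matrix \<open>g (Xs ! a) (e (I ! b))\<close>. The
  right side has \<open>Xs\<close> as its argument, as needed to resum with
  \<open>alt_form_eq_sum_wedge\<close>.\<close>

lemma decomposable_dual_basis:
  assumes "length Xs = q" "set Xs \<subseteq> V" "I \<in> index_lists n q"
  shows "decomposable V Xs (map dual_basis I) = wedge_list (map (flat_vector V g) (map e I)) Xs"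
proof -
  interpret dual: orthonormal_basis "alt_forms V 1" dual_metric dual_basis n
    by (rule orthonormal_basis_dual)
  have "dual_metric (map (flat_vector V g) Xs ! j) (map dual_basis I ! \<pi> j) = g (Xs ! j) (map e I ! \<pi> j)"
    if "\<pi> permutes {..<q}" "j < q" for \<pi> j
  proof -
    have "length I = q" "\<pi> j < q"
      using assms permutes_in_image[OF that(1), of j] that(2) by (auto simp: index_lists_def)
    moreover from this have "I ! \<pi> j < n"
      using assms by (simp add: index_lists_nth)
    ultimately show ?thesis
      using assms that by (simp add: dual_metric_basis) (simp add: basis_in)
  qed
  then have "decomposable V Xs (map dual_basis I) = wedge_list (map (flat_vector V g) Xs) (map e I)"
    using assms dual.index_lists_map[OF assms(3)] index_lists_map[OF assms(3)]
    by (subst decomposable_eq, simp, subst dual.wedge_flat_eq, simp, simp del: One_nat_def, subst wedge_flat_eq)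
      (simp_all del: map_map nth_map)
  then show ?thesis
    using wedge_flat_commute[of "map e I" Xs] assms index_lists_map[OF assms(3)] by simp
qed

text \<open>
  \<open>Q \<mapsto> 1 / q! \<Sum>\<^sub>I Q(e\<^sup>I) f(e\<^sub>I)\<close> is defined and linear on all functions \<open>Q\<close>, so it is a witness for the
  choice in \<open>linear_extension\<close> and no extension from the subspace of multivectors is needed.
\<close>

lemma linear_extension_eq:
  assumes f: "\<And>ys. (\<lambda>Xs. if length Xs = q \<and> set Xs \<subseteq> V then f Xs ys else 0) \<in> alt_forms V q"
    and Q: "Q \<in> multivectors V q"
  shows "linear_extension V q f Q =
    (\<Sum>I\<in>index_lists n q. (Q (map dual_basis I) / fact q) *\<^sub>R (f (map e I) :: 'b \<Rightarrow> real))"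
proof -
  interpret dual: orthonormal_basis "alt_forms V 1" dual_metric dual_basis n
    by (rule orthonormal_basis_dual)
  let ?S = "\<lambda>F. linear F \<and> (\<forall>Xs. length Xs = q \<and> set Xs \<subseteq> V \<longrightarrow> F (decomposable V Xs) = f Xs)"
  define F where "F R = (\<Sum>I\<in>index_lists n q. (R (map dual_basis I) / fact q) *\<^sub>R f (map e I))"
    for R :: "('v list \<Rightarrow> real) list \<Rightarrow> real"
  have "linear F"
    by (rule linearI) (simp_all add: F_def add_divide_distrib scaleR_add_left sum.distrib scaleR_sum_right)
  moreover have "F (decomposable V Xs) = f Xs" if Xs: "length Xs = q" "set Xs \<subseteq> V" for Xs
  proof
    fix ys
    \<comment> \<open>With \<open>ys\<close> fixed, this is the basis expansion of the form taking
      \<open>Xs\<close> to \<open>f Xs ys\<close>; the case distinction that makes it a form is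
      inserted next.\<close>
    have "F (decomposable V Xs) ys = (\<Sum>I\<in>index_lists n q.
        (f (map e I) ys / fact q) *\<^sub>R wedge_list (map (flat_vector V g) (map e I)) Xs)"
      unfolding F_def sum_fun_apply using Xs by (intro sum.cong) (auto simp: decomposable_dual_basis)
    also have "\<dots> = (\<Sum>I\<in>index_lists n q.
        ((if length (map e I) = q \<and> set (map e I) \<subseteq> V then f (map e I) ys else 0) / fact q) *\<^sub>R
          wedge_list (map (flat_vector V g) (map e I))) Xs"
      unfolding sum_fun_apply
    proof (rule sum.cong)
      show "(f (map e I) ys / fact q) *\<^sub>R wedge_list (map (flat_vector V g) (map e I)) Xs =
          (((if length (map e I) = q \<and> set (map e I) \<subseteq> V then f (map e I) ys else 0) / fact q) *\<^sub>R
            wedge_list (map (flat_vector V g) (map e I))) Xs" if "I \<in> index_lists n q" for I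
        using index_lists_map[OF that] by simp
    qed simp
    also have "\<dots> = f Xs ys"
      using fun_cong[OF alt_form_eq_sum_wedge[OF f[of ys]], of Xs] Xs by simp
    finally show "F (decomposable V Xs) ys = f Xs ys" .
  qed
  ultimately have S: "?S F"
    by blast
  have "?S (linear_extension V q f)"
    unfolding linear_extension_def by (rule someI[of ?S, OF S])
  then have lin: "linear (linear_extension V q f)"
    and ext: "\<And>Xs. length Xs = q \<Longrightarrow> set Xs \<subseteq> V \<Longrightarrow> linear_extension V q f (decomposable V Xs) = f Xs"
    by auto
  \<comment> \<open>The chosen map need not equal \<open>F\<close> everywhere. It is linear with
    prescribed values on decomposables, and \<open>Q\<close> is a combination of these by the basis
    expansion in the dual instance.\<close>
  have "Q = (\<Sum>I\<in>index_lists n q. (Q (map dual_basis I) / fact q) *\<^sub>R decomposable V (map e I))"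
  proof -
    have "wedge_list (map (flat_vector (alt_forms V 1) dual_metric) (map dual_basis I)) =
        decomposable V (map e I)" if "I \<in> index_lists n q" for I
      using index_lists_map[OF that] by (simp add: decomposable_eq comp_def)
    then show ?thesis
      using dual.alt_form_eq_sum_wedge[of Q q] Q by (simp add: multivectors_def del: map_map)
  qed
  then have "linear_extension V q f Q = linear_extension V q f
      (\<Sum>I\<in>index_lists n q. (Q (map dual_basis I) / fact q) *\<^sub>R decomposable V (map e I))"
    by (rule arg_cong)
  also have "\<dots> = (\<Sum>I\<in>index_lists n q. (Q (map dual_basis I) / fact q) *\<^sub>R f (map e I))"
    using index_lists_map by (simp add: linear_sum[OF lin] linear_scale[OF lin] ext)
  finally show ?thesis .
qed

section \<open>The flat isomorphism on multivectors\<close>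

lemma flat_vector_linear:
  assumes "x \<in> V" "y \<in> V"
  shows "flat_vector V g (a *\<^sub>R x + b *\<^sub>R y) = a *\<^sub>R flat_vector V g x + b *\<^sub>R flat_vector V g y"
proof
  fix zs
  show "flat_vector V g (a *\<^sub>R x + b *\<^sub>R y) zs = (a *\<^sub>R flat_vector V g x + b *\<^sub>R flat_vector V g y) zs"
    using assms by (cases zs) (simp_all add: flat_vector_def metric_linear)
qed

lemma pullback_flat_in_alt_forms:
  assumes Q: "Q \<in> multivectors V q"
  shows "(\<lambda>xs. if length xs = q \<and> set xs \<subseteq> V then Q (map (flat_vector V g) xs) else 0) \<in> alt_forms V q"
proof (rule alt_formsI)
  fix xs :: "'v list" and i x y a b
  assume xs: "length xs = q" "set xs \<subseteq> V" "i < q" "x \<in> V" "y \<in> V"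
  have upd: "set (xs[i := u]) \<subseteq> V" if "u \<in> V" for u
    using xs that by (meson set_update_subsetI)
  have "set (map (flat_vector V g) xs) \<subseteq> alt_forms V 1"
    using xs flat_vector_in_alt_forms by auto
  then show "(if length (xs[i := a *\<^sub>R x + b *\<^sub>R y]) = q \<and> set (xs[i := a *\<^sub>R x + b *\<^sub>R y]) \<subseteq> V
        then Q (map (flat_vector V g) (xs[i := a *\<^sub>R x + b *\<^sub>R y])) else 0) =
      a * (if length (xs[i := x]) = q \<and> set (xs[i := x]) \<subseteq> V
        then Q (map (flat_vector V g) (xs[i := x])) else 0) +
      b * (if length (xs[i := y]) = q \<and> set (xs[i := y]) \<subseteq> V
        then Q (map (flat_vector V g) (xs[i := y])) else 0)"
    using xs upd subspace flat_vector_in_alt_forms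
      alt_forms_linear[OF Q[unfolded multivectors_def], of "map (flat_vector V g) xs" i
        "flat_vector V g x" "flat_vector V g y" a b]
    by (simp add: subspace_add subspace_scale map_update flat_vector_linear)
next
  fix xs :: "'v list"
  assume "\<not> distinct xs"
  then have "\<not> distinct (map (flat_vector V g) xs)"
    by (simp add: distinct_map)
  then show "(if length xs = q \<and> set xs \<subseteq> V then Q (map (flat_vector V g) xs) else 0) = 0"
    using alt_forms_not_distinct[OF Q[unfolded multivectors_def]] by auto
qed auto

text \<open>Lowering indices pulls \<open>Q\<close> back along the flat map of vectors, a
  description free of the basis. Both sides have the same expansion in wedges of the dual basis,
  with the values of \<open>Q\<close> on that basis as coefficients.\<close>

lemma flat_eq:
  assumes Q: "Q \<in> multivectors V q"
  shows "flat V g q Q = (\<lambda>xs. if length xs = q \<and> set xs \<subseteq> V then Q (map (flat_vector V g) xs) else 0)"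
    (is "_ = ?R")
proof -
  have "(\<lambda>Xs. if length Xs = q \<and> set Xs \<subseteq> V then wedge_list (map (flat_vector V g) Xs) ys else 0)
      \<in> alt_forms V q" for ys
  proof (cases "length ys = q \<and> set ys \<subseteq> V")
    case True
    have "(\<lambda>Xs. if length Xs = q \<and> set Xs \<subseteq> V then wedge_list (map (flat_vector V g) Xs) ys else 0) =
        wedge_list (map (flat_vector V g) ys)"
      using True alt_forms_outside[OF wedge_flat_in_alt_forms, of ys] wedge_flat_commute[of ys]
      by (intro ext) auto
    then show ?thesis
      using True wedge_flat_in_alt_forms[of ys] by simp
  next
    case False
    have "(\<lambda>Xs. if length Xs = q \<and> set Xs \<subseteq> V then wedge_list (map (flat_vector V g) Xs) ys else 0) = 0"
      using False alt_forms_outside[OF wedge_flat_in_alt_forms, of _ ys] by (intro ext) auto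
    then show ?thesis
      by (simp only: zero_in_alt_forms)
  qed
  then have "flat V g q Q = (\<Sum>I\<in>index_lists n q. (Q (map dual_basis I) / fact q) *\<^sub>R
      wedge_list (map (flat_vector V g) (map e I)))"
    unfolding flat_def by (rule linear_extension_eq[OF _ Q])
  also have "\<dots> = (\<Sum>I\<in>index_lists n q. (?R (map e I) / fact q) *\<^sub>R
      wedge_list (map (flat_vector V g) (map e I)))"
  proof (rule sum.cong)
    show "(Q (map dual_basis I) / fact q) *\<^sub>R wedge_list (map (flat_vector V g) (map e I)) =
        (?R (map e I) / fact q) *\<^sub>R wedge_list (map (flat_vector V g) (map e I))"
      if "I \<in> index_lists n q" for I
      using index_lists_map[OF that] by (simp add: comp_def)
  qed simp
  also have "\<dots> = ?R"
    by (rule alt_form_eq_sum_wedge[OF pullback_flat_in_alt_forms[OF Q], symmetric])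
  finally show ?thesis .
qed

lemma flat_in_alt_forms:
  "Q \<in> multivectors V q \<Longrightarrow> flat V g q Q \<in> alt_forms V q"
  by (simp add: flat_eq pullback_flat_in_alt_forms)

section \<open>Contraction by a form\<close>

definition form_contract :: "nat \<Rightarrow> ('v list \<Rightarrow> real) \<Rightarrow> ('v list \<Rightarrow> real) \<Rightarrow> 'v list \<Rightarrow> real" where
  "form_contract k \<beta> \<phi> = (\<Sum>I\<in>index_lists n k. (\<beta> (map e I) / fact k) *\<^sub>R (\<lambda>ys. \<phi> (map e I @ ys)))"

lemma fold_interior: "fold interior Xs \<phi> = (\<lambda>ys. \<phi> (Xs @ ys))"
  by (induction Xs arbitrary: \<phi>) (simp_all add: interior_def)

text \<open>A multivector contracts through its components on the dual basis, and by
  \<open>flat_eq\<close> these are the components of its flat on \<open>e\<close>.\<close>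

lemma contract_eq:
  assumes Q: "Q \<in> multivectors V q" and \<phi>: "\<phi> \<in> alt_forms V m"
  shows "contract V q Q \<phi> = form_contract q (flat V g q Q) \<phi>"
proof -
  have "(\<lambda>Xs. if length Xs = q \<and> set Xs \<subseteq> V then fold interior Xs \<phi> ys else 0) \<in> alt_forms V q" for ys
  proof -
    have "(\<lambda>Xs. if length Xs = q \<and> set Xs \<subseteq> V then fold interior Xs \<phi> ys else 0) =
        (\<lambda>Xs. if length Xs = q then \<phi> (Xs @ ys) else 0)"
      using alt_forms_outside[OF \<phi>, of "_ @ ys"] by (intro ext) (auto simp: fold_interior)
    then show ?thesis
      using alt_forms_suffix[OF \<phi>] by simp
  qed
  then have "contract V q Q \<phi> =
      (\<Sum>I\<in>index_lists n q. (Q (map dual_basis I) / fact q) *\<^sub>R fold interior (map e I) \<phi>)"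
    unfolding contract_def by (rule linear_extension_eq[OF _ Q])
  also have "\<dots> = form_contract q (flat V g q Q) \<phi>"
    unfolding form_contract_def fold_interior
  proof (rule sum.cong)
    show "(Q (map dual_basis I) / fact q) *\<^sub>R (\<lambda>ys. \<phi> (map e I @ ys)) =
        (flat V g q Q (map e I) / fact q) *\<^sub>R (\<lambda>ys. \<phi> (map e I @ ys))"
      if "I \<in> index_lists n q" for I
      using index_lists_map[OF that] by (simp add: flat_eq[OF Q] comp_def)
  qed simp
  finally show ?thesis .
qed

lemma form_contract_in_alt_forms:
  assumes "\<phi> \<in> alt_forms V m"
  shows "form_contract k \<beta> \<phi> \<in> alt_forms V (m - k)"
  unfolding form_contract_def
proof (intro subspace_sum subspace_scale subspace_alt_forms)
  show "(\<lambda>ys. \<phi> (map e I @ ys)) \<in> alt_forms V (m - k)" if "I \<in> index_lists n k" for I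
    using alt_forms_prefix[OF assms, of "map e I"] index_lists_map(1)[OF that] by simp
qed

section \<open>The induced metric on forms\<close>

lemma det_metric_eq:
  assumes "length Xs = l" "length Ys = l" "set Ys \<subseteq> V"
  shows "Determinant.det (Matrix.mat l l (\<lambda>(a, b). g (Xs ! a) (Ys ! b))) =
    wedge_list (map (flat_vector V g) Xs) Ys"
proof -
  have "\<pi> i < l" if "\<pi> permutes {..<l}" "i < l" for \<pi> i
    using permutes_in_image[OF that(1), of i] that(2) by simp
  then show ?thesis
    using assms by (auto simp: wedge_flat_eq det_def'[of _ l] lessThan_atLeast0 intro!: sum.cong prod.cong)
qed

text \<open>The coordinate formula \<open>B\<close> satisfies the determinant rule, so the choice in
  \<open>form_metric\<close> has a witness; bilinear maps agreeing on wedges of the dual basis agree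
  on all \<open>l\<close>-forms, so the chosen map coincides with \<open>B\<close> there.\<close>

lemma form_metric_eq:
  assumes \<alpha>: "\<alpha> \<in> alt_forms V l" and \<beta>: "\<beta> \<in> alt_forms V l"
  shows "form_metric V g l \<alpha> \<beta> = (\<Sum>I\<in>index_lists n l. \<alpha> (map e I) * \<beta> (map e I)) / fact l"
proof -
  let ?w = "\<lambda>Xs. wedge_list (map (flat_vector V g) Xs)"
  let ?S = "\<lambda>B. bilinear B \<and> (\<forall>Xs Ys. length Xs = l \<and> length Ys = l \<and> set Xs \<subseteq> V \<and> set Ys \<subseteq> V \<longrightarrow>
        B (?w Xs) (?w Ys) = Determinant.det (Matrix.mat l l (\<lambda>(a, b). g (Xs ! a) (Ys ! b))))"
  define B where "B \<alpha> \<beta> = (\<Sum>I\<in>index_lists n l. \<alpha> (map e I) * \<beta> (map e I)) / fact l"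
    for \<alpha> \<beta> :: "'v list \<Rightarrow> real"
  have B: "?S B"
  proof (intro conjI allI impI)
    show "bilinear B"
      unfolding bilinear_def
      by (intro conjI allI linearI)
        (simp_all add: B_def algebra_simps sum.distrib add_divide_distrib sum_distrib_left)
    fix Xs Ys
    assume XY: "length Xs = l \<and> length Ys = l \<and> set Xs \<subseteq> V \<and> set Ys \<subseteq> V"
    have "?w Ys (map e I) = ?w (map e I) Ys" if "I \<in> index_lists n l" for I
      using XY index_lists_map[OF that] wedge_flat_commute[of "map e I" Ys] by simp
    \<comment> \<open>The expansion of the wedge of \<open>Xs\<close>, evaluated at
      \<open>Ys\<close>, is already the coordinate formula once symmetry moves \<open>Ys\<close>
      back into the wedge.\<close>
    moreover have "?w Xs Ys = (\<Sum>I\<in>index_lists n l. (?w Xs (map e I) / fact l) * ?w (map e I) Ys)"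
      using fun_cong[OF alt_form_eq_sum_wedge[OF wedge_flat_in_alt_forms[of Xs]], of Ys] XY
      by (simp add: sum_fun_apply)
    ultimately have "B (?w Xs) (?w Ys) = ?w Xs Ys"
      by (simp add: B_def sum_divide_distrib del: map_map)
    then show "B (?w Xs) (?w Ys) = Determinant.det (Matrix.mat l l (\<lambda>(a, b). g (Xs ! a) (Ys ! b)))"
      using XY det_metric_eq by simp
  qed
  have C: "?S (form_metric V g l)"
    unfolding form_metric_def by (rule someI[of ?S, OF B])
  have sum_eq: "C \<alpha> \<beta> = (\<Sum>I\<in>index_lists n l. \<Sum>J\<in>index_lists n l.
      (\<alpha> (map e I) / fact l) * ((\<beta> (map e J) / fact l) * C (?w (map e I)) (?w (map e J))))"
    if "bilinear C" for C
  proof -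
    have l1: "linear (\<lambda>x. C x y)" and l2: "linear (C x)" for x y
      using that by (auto simp: bilinear_def)
    have "C \<alpha> \<beta> = C (\<Sum>I\<in>index_lists n l. (\<alpha> (map e I) / fact l) *\<^sub>R ?w (map e I))
        (\<Sum>J\<in>index_lists n l. (\<beta> (map e J) / fact l) *\<^sub>R ?w (map e J))"
      using alt_form_eq_sum_wedge[OF \<alpha>] alt_form_eq_sum_wedge[OF \<beta>] by simp
    also have "\<dots> = (\<Sum>I\<in>index_lists n l. (\<alpha> (map e I) / fact l) *
        C (?w (map e I)) (\<Sum>J\<in>index_lists n l. (\<beta> (map e J) / fact l) *\<^sub>R ?w (map e J)))"
      by (subst linear_sum[OF l1]) (simp add: linear_scale[OF l1] del: map_map)
    also have "\<dots> = (\<Sum>I\<in>index_lists n l. \<Sum>J\<in>index_lists n l.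
        (\<alpha> (map e I) / fact l) * ((\<beta> (map e J) / fact l) * C (?w (map e I)) (?w (map e J))))"
      by (simp only: linear_sum[OF l2] linear_scale[OF l2] sum_distrib_left real_scaleR_def)
    finally show ?thesis .
  qed
  have "form_metric V g l (?w (map e I)) (?w (map e J)) = B (?w (map e I)) (?w (map e J))"
    if "I \<in> index_lists n l" "J \<in> index_lists n l" for I J
    using B C index_lists_map[OF that(1)] index_lists_map[OF that(2)] by (simp del: map_map)
  then have "form_metric V g l \<alpha> \<beta> = B \<alpha> \<beta>"
    using B C by (simp add: sum_eq del: map_map)
  then show ?thesis
    by (simp add: B_def)
qed

end

section \<open>The volume form and the Hodge star\<close>

context orthonormal_basis
begin

definition vol :: "'v list \<Rightarrow> real" where
  "vol = wedge_list (map (flat_vector V g) (map e [0..<n]))"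

lemma upt_index_list: "[0..<n] \<in> index_lists n n"
  by (auto simp: index_lists_def)

lemma vol_in_alt_forms: "vol \<in> alt_forms V n"
  unfolding vol_def using wedge_flat_in_alt_forms[of "map e [0..<n]"] index_lists_map(2)[OF upt_index_list]
  by simp

lemma wedge_flat_orthonormal:
  assumes "length Es = l" "set Es \<subseteq> V"
    and "\<And>i j. i < l \<Longrightarrow> j < l \<Longrightarrow> g (Es ! i) (Es ! j) = (if i = j then 1 else 0)"
  shows "wedge_list (map (flat_vector V g) Es) Es = 1"
proof -
  have "(\<Prod>j<l. g (Es ! j) (Es ! \<pi> j)) = (if \<pi> = id then 1 else 0)" if \<pi>: "\<pi> permutes {..<l}" for \<pi>
  proof (cases "\<pi> = id")
    case True
    then show ?thesis
      using assms by simp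
  next
    case False
    then obtain j where j: "\<pi> j \<noteq> j"
      by (auto simp: fun_eq_iff)
    then have "j < l"
      using permutes_not_in[OF \<pi>, of j] by auto
    then have "g (Es ! j) (Es ! \<pi> j) = 0"
      using assms(3)[of j "\<pi> j"] j permutes_in_image[OF \<pi>, of j] by simp
    then show ?thesis
      using False \<open>j < l\<close> by auto
  qed
  then have "wedge_list (map (flat_vector V g) Es) Es =
      (\<Sum>\<pi> | \<pi> permutes {..<l}. of_int (sign \<pi>) * (if \<pi> = id then 1 else 0))"
    using assms by (simp add: wedge_flat_eq)
  also have "\<dots> = (\<Sum>\<pi> | \<pi> permutes {..<l}. if \<pi> = id then 1 else 0)"
    by (rule sum.cong) auto
  also have "\<dots> = 1"
    by (simp add: finite_permutations permutes_id)
  finally show ?thesis .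
qed

lemma vol_basis: "vol (map e [0..<n]) = 1"
  unfolding vol_def
  by (rule wedge_flat_orthonormal[of _ n]) (use index_lists_map(2)[OF upt_index_list] in \<open>auto simp: orthonormal\<close>)

lemma index_list_permutation:
  assumes "I \<in> index_lists n n" "distinct I"
  obtains \<pi> where "\<pi> permutes {..<n}" "I = permute_list \<pi> [0..<n]"
proof -
  have "set I = {..<n}"
    using assms by (intro card_subset_eq) (auto simp: index_lists_def distinct_card)
  then have "mset I = mset [0..<n]"
    using set_eq_iff_mset_eq_distinct[OF assms(2) distinct_upt] by (metis atLeast_upt)
  then obtain \<pi> where "\<pi> permutes {..<length [0..<n]}" "permute_list \<pi> [0..<n] = I"
    by (rule mset_eq_permutation)
  then show ?thesis
    using that by simp
qed

lemma vol_permute_basis: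
  assumes "\<pi> permutes {..<n}"
  shows "vol (map e (permute_list \<pi> [0..<n])) = of_int (sign \<pi>)"
proof -
  have "map e (permute_list \<pi> [0..<n]) = permute_list \<pi> (map e [0..<n])"
    using assms by (simp add: permute_list_map)
  then show ?thesis
    using assms alt_forms_permute[OF subspace vol_in_alt_forms, of \<pi> "map e [0..<n]"] by (simp add: vol_basis)
qed

text \<open>Components of \<open>vol\<close> on rearrangements of the basis are permutation signs.
  Later cancellations use this square in place of the permutations themselves.\<close>

lemma vol_sq:
  assumes "I \<in> index_lists n n" "distinct I"
  shows "vol (map e I) * vol (map e I) = 1"
proof -
  obtain \<pi> where "\<pi> permutes {..<n}" "I = permute_list \<pi> [0..<n]"
    using index_list_permutation[OF assms] .
  then show ?thesis
    by (simp add: vol_permute_basis flip: of_int_mult)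
qed

lemma vol_not_distinct: "\<not> distinct I \<Longrightarrow> vol (map e I) = 0"
  by (rule alt_forms_not_distinct[OF vol_in_alt_forms]) (simp add: distinct_map)

lemma top_form_eq:
  assumes \<omega>: "\<omega> \<in> alt_forms V n"
  shows "\<omega> = \<omega> (map e [0..<n]) *\<^sub>R vol"
proof (rule alt_forms_eqI[OF \<omega>])
  show "\<omega> (map e [0..<n]) *\<^sub>R vol \<in> alt_forms V n"
    by (intro subspace_scale subspace_alt_forms vol_in_alt_forms)
  fix I
  assume "I \<in> index_lists n n" "distinct I"
  then obtain \<pi> where \<pi>: "\<pi> permutes {..<n}" "I = permute_list \<pi> [0..<n]"
    by (rule index_list_permutation)
  have "\<omega> (map e I) = of_int (sign \<pi>) * \<omega> (map e [0..<n])"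
    using alt_forms_permute[OF subspace \<omega>, of \<pi> "map e [0..<n]"] \<pi> by (simp add: permute_list_map)
  then show "\<omega> (map e I) = (\<omega> (map e [0..<n]) *\<^sub>R vol) (map e I)"
    using \<pi> by (simp add: vol_permute_basis)
qed

text \<open>The set of positive bases is given by a form \<mu>, as in \<open>is_orientation\<close>.
  Existence needs that \<open>vol\<close> is 1 on every positive orthonormal list; uniqueness uses
  that \<open>e\<close> gives such a list and that one value determines a top form.\<close>

lemma volume_form_eq:
  assumes \<mu>: "\<mu> \<in> alt_forms V n" and pos: "\<mu> (map e [0..<n]) > 0"
  shows "volume_form V g {Es. \<mu> Es > 0} n = vol"
  unfolding volume_form_def
proof (rule the_equality)
  let ?E = "map e [0..<n]"
  show "vol \<in> alt_forms V n \<and> (\<forall>Es\<in>{Es. \<mu> Es > 0}.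
      (\<forall>i<n. \<forall>j<n. g (Es ! i) (Es ! j) = (if i = j then 1 else 0)) \<longrightarrow> vol Es = 1)"
  proof (intro conjI vol_in_alt_forms ballI impI)
    fix Es
    assume Es: "Es \<in> {Es. \<mu> Es > 0}"
      and on: "\<forall>i<n. \<forall>j<n. g (Es ! i) (Es ! j) = (if i = j then 1 else 0)"
    \<comment> \<open>Positivity of \<mu> supplies this, because a form is 0 on all other
      lists.\<close>
    have len: "length Es = n" "set Es \<subseteq> V"
      using Es alt_forms_outside[OF \<mu>, of Es] by force+
    let ?w = "wedge_list (map (flat_vector V g) Es)"
    have "?w ?E = vol Es"
      unfolding vol_def using len index_lists_map(2)[OF upt_index_list]
      by (intro wedge_flat_commute) auto
    \<comment> \<open>The Gram determinant of \<open>Es\<close> is the square of its volume. It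
      equals 1, so the volume is 1 or -1, and comparison with \<mu> excludes -1.\<close>
    then have "?w Es = vol Es * vol Es"
      using fun_cong[OF top_form_eq[of ?w], of Es] wedge_flat_in_alt_forms[of Es] len by simp
    moreover have "?w Es = 1"
      using on len by (intro wedge_flat_orthonormal[of _ n]) auto
    moreover have "vol Es > 0"
    proof -
      have "\<mu> Es = \<mu> ?E * vol Es"
        using fun_cong[OF top_form_eq[OF \<mu>], of Es] by simp
      then show ?thesis
        using Es pos by (simp add: zero_less_mult_iff)
    qed
    ultimately show "vol Es = 1"
      using power2_eq_1_iff[of "vol Es"] by (auto simp: power2_eq_square)
  qed
  fix \<omega>
  assume \<omega>: "\<omega> \<in> alt_forms V n \<and> (\<forall>Es\<in>{Es. \<mu> Es > 0}.
      (\<forall>i<n. \<forall>j<n. g (Es ! i) (Es ! j) = (if i = j then 1 else 0)) \<longrightarrow> \<omega> Es = 1)"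
  then have "\<omega> ?E = 1"
    using pos by (simp add: orthonormal)
  then show "\<omega> = vol"
    using top_form_eq[of \<omega>] \<omega> by simp
qed

section \<open>Complementary index lists and components of the star\<close>

lemma index_lists_complement:
  assumes "I \<in> index_lists n l" "J \<in> index_lists n (n - l)" "l \<le> n" "distinct (I @ J)"
  shows "set I = {..<n} - set J" "set J = {..<n} - set I"
proof -
  have "set (I @ J) = {..<n}"
    using assms distinct_card[OF assms(4)] by (intro card_subset_eq) (auto simp: index_lists_def)
  then show "set I = {..<n} - set J" "set J = {..<n} - set I"
    using assms by auto
qed

lemma ex_complement:
  assumes "I \<in> index_lists n l" "distinct I"
  obtains J where "J \<in> index_lists n (n - l)" "distinct (I @ J)"
proof
  let ?J = "sorted_list_of_set ({..<n} - set I)"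
  have "length ?J = n - l"
    using assms by (simp add: index_lists_def card_Diff_subset distinct_card)
  then show "?J \<in> index_lists n (n - l)" "distinct (I @ ?J)"
    using assms by (auto simp: index_lists_def)
qed

lemma card_complement:
  assumes "I \<in> index_lists n l" "distinct I" "l \<le> n"
  shows "card {J \<in> index_lists n (n - l). distinct (I @ J)} = fact (n - l)"
proof -
  have "{J \<in> index_lists n (n - l). distinct (I @ J)} = permutations_of_set ({..<n} - set I)"
  proof (intro equalityI subsetI)
    fix J
    assume "J \<in> {J \<in> index_lists n (n - l). distinct (I @ J)}"
    then show "J \<in> permutations_of_set ({..<n} - set I)"
      using index_lists_complement(2)[of I l J] assms by (auto intro!: permutations_of_setI)
  next
    fix J
    assume "J \<in> permutations_of_set ({..<n} - set I)"
    then have J: "set J = {..<n} - set I" "distinct J"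
      by (auto dest: permutations_of_setD)
    then have "length J = n - l"
      using assms by (simp add: index_lists_def card_Diff_subset distinct_card flip: distinct_card[of J])
    then show "J \<in> {J \<in> index_lists n (n - l). distinct (I @ J)}"
      using J assms by (auto simp: index_lists_def)
  qed
  then show ?thesis
    using assms by (simp add: index_lists_def card_Diff_subset distinct_card)
qed

lemma append_index_lists:
  "I \<in> index_lists n l \<Longrightarrow> J \<in> index_lists n m \<Longrightarrow> I @ J \<in> index_lists n (l + m)"
  by (auto simp: index_lists_def)

text \<open>A list \<open>K\<close> in the sum survives only if it avoids \<open>J\<close>, hence
  only if it rearranges \<open>I\<close>. Then \<alpha> and \<open>vol\<close> change by the same
  sign, so all \<open>fact l\<close> rearrangements contribute the same term.\<close>

lemma form_contract_vol_apply:
  assumes \<alpha>: "\<alpha> \<in> alt_forms V l" and l: "l \<le> n"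
    and I: "I \<in> index_lists n l" and J: "J \<in> index_lists n (n - l)" and d: "distinct (I @ J)"
  shows "form_contract l \<alpha> vol (map e J) = \<alpha> (map e I) * vol (map e (I @ J))"
proof -
  let ?f = "\<lambda>K. \<alpha> (map e K) * vol (map e (K @ J))"
  have lenI: "length I = l"
    using I by (simp add: index_lists_def)
  have sub: "permutations_of_set (set I) \<subseteq> index_lists n l"
    using I d by (auto simp: index_lists_def dest: permutations_of_setD length_finite_permutations_of_set)
      (metis distinct_append distinct_card length_finite_permutations_of_set)
  have "form_contract l \<alpha> vol (map e J) = (\<Sum>K\<in>index_lists n l. ?f K) / fact l"
    by (simp add: form_contract_def sum_fun_apply sum_divide_distrib)
  also have "(\<Sum>K\<in>index_lists n l. ?f K) = (\<Sum>K\<in>permutations_of_set (set I). ?f K)"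
  proof (intro sum.mono_neutral_right ballI)
    fix K
    assume K: "K \<in> index_lists n l - permutations_of_set (set I)"
    have "\<not> distinct (K @ J)"
    proof
      assume D: "distinct (K @ J)"
      then have "set K = set I"
        using index_lists_complement(1)[of K l J] index_lists_complement(1)[of I l J] assms K by simp
      then show False
        using K D by (auto intro: permutations_of_setI)
    qed
    then show "?f K = 0"
      by (simp del: map_append distinct_append add: vol_not_distinct)
  qed (use sub in auto)
  also have "\<dots> = (\<Sum>K\<in>permutations_of_set (set I). ?f I)"
  proof (rule sum.cong)
    fix K
    assume "K \<in> permutations_of_set (set I)"
    then have "mset K = mset I"
      using d set_eq_iff_mset_eq_distinct[of K I] by (simp add: permutations_of_setD)
    then obtain \<pi> where \<pi>: "\<pi> permutes {..<l}" "permute_list \<pi> I = K"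
      using mset_eq_permutation lenI by metis
    have K: "map e K = permute_list \<pi> (map e I)"
      using \<pi> lenI by (auto simp: permute_list_map)
    have "\<alpha> (map e K) = of_int (sign \<pi>) * \<alpha> (map e I)"
      unfolding K using \<pi> lenI by (intro alt_forms_permute[OF subspace \<alpha>]) simp
    moreover have "vol (map e K @ map e J) = of_int (sign \<pi>) * vol (map e I @ map e J)"
      using alt_forms_permute[OF subspace alt_forms_suffix[OF vol_in_alt_forms, of l "map e J"], of \<pi> "map e I"]
        \<pi> lenI by (simp add: K)
    moreover have "of_int (sign \<pi>) * of_int (sign \<pi>) = (1::real)"
      by (simp flip: of_int_mult)
    ultimately show "?f K = ?f I"
      by (simp add: mult.left_commute flip: mult.assoc)
  qed simp
  also have "\<dots> = fact l * ?f I"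
    using d lenI by (simp add: distinct_card)
  finally show ?thesis
    by simp
qed

lemma vol_swap:
  assumes "I \<in> index_lists n l" "J \<in> index_lists n (n - l)"
  shows "vol (map e (J @ I)) = (-1) ^ (l * (n - l)) * vol (map e (I @ J))"
  using alt_forms_block_swap[OF subspace vol_in_alt_forms, of "map e J" "map e I" "[]"] assms
  by (simp add: index_lists_def mult.commute)

text \<open>The permutations in \<open>wedge\<close> are traded for index lists: \<pi> corresponds
  to a list without repetitions, its sign is the component of \<open>vol\<close> there, and lists
  with repetitions may be added since \<open>vol\<close> vanishes on them.\<close>

lemma wedge_basis:
  assumes "l \<le> n"
  shows "wedge l (n - l) \<beta> \<gamma> (map e [0..<n]) =
    (\<Sum>I\<in>index_lists n l. \<Sum>J\<in>index_lists n (n - l).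
       vol (map e (I @ J)) * (\<beta> (map e I) * \<gamma> (map e J))) / (fact l * fact (n - l))"
proof -
  let ?h = "\<lambda>K. vol (map e K) * (\<beta> (map e (take l K)) * \<gamma> (map e (drop l K)))"
  let ?P = "{\<pi>. \<pi> permutes {..<n}}"
  let ?p = "\<lambda>\<pi>. permute_list \<pi> [0..<n]"
  have inj: "inj_on ?p ?P"
  proof (rule inj_onI)
    fix \<pi> \<rho>
    assume \<pi>: "\<pi> \<in> ?P" and \<rho>: "\<rho> \<in> ?P" and eq: "?p \<pi> = ?p \<rho>"
    show "\<pi> = \<rho>"
    proof
      fix x
      show "\<pi> x = \<rho> x"
      proof (cases "x < n")
        case True
        then have "\<pi> x < n" "\<rho> x < n"
          using \<pi> \<rho> permutes_in_image[of _ "{..<n}" x] by auto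
        moreover have "?p \<pi> ! x = ?p \<rho> ! x"
          using eq by simp
        ultimately show ?thesis
          using True \<pi> \<rho> by (simp add: permute_list_nth)
      next
        case False
        then show ?thesis
          using \<pi> \<rho> permutes_not_in[of _ "{..<n}" x] by (metis lessThan_iff mem_Collect_eq)
      qed
    qed
  qed
  have image: "?p ` ?P = {K \<in> index_lists n n. distinct K}"
  proof (intro equalityI subsetI)
    fix K
    assume "K \<in> {K \<in> index_lists n n. distinct K}"
    then show "K \<in> ?p ` ?P"
      using index_list_permutation by blast
  qed (auto simp: index_lists_def)
  have "(\<Sum>\<pi>\<in>?P. of_int (sign \<pi>) * (\<beta> (take l (permute_list \<pi> (map e [0..<n]))) *
      \<gamma> (drop l (permute_list \<pi> (map e [0..<n]))))) = (\<Sum>\<pi>\<in>?P. ?h (?p \<pi>))"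
    by (rule sum.cong) (simp_all add: vol_permute_basis permute_list_map take_map drop_map)
  also have "\<dots> = (\<Sum>K\<in>?p ` ?P. ?h K)"
    by (simp add: sum.reindex[OF inj])
  also have "\<dots> = (\<Sum>K\<in>index_lists n n. ?h K)"
    unfolding image by (rule sum.mono_neutral_left) (auto simp: vol_not_distinct)
  also have "\<dots> = (\<Sum>I\<in>index_lists n l. \<Sum>J\<in>index_lists n (n - l).
       vol (map e (I @ J)) * (\<beta> (map e I) * \<gamma> (map e J)))"
    using sum_index_lists_append[of ?h n l "n - l"] assms by (simp add: index_lists_def)
  finally show ?thesis
    using wedge_eq[of "map e [0..<n]" l "n - l" \<beta> \<gamma>] assms by simp
qed

text \<open>For fixed distinct \<open>I\<close>, the lists \<open>J\<close> that count are the
  \<open>fact (n - l)\<close> orderings of its complement, and each contributes the same product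
  because the two components of \<open>vol\<close> multiply to 1.\<close>

lemma wedge_star_basis:
  assumes \<alpha>: "\<alpha> \<in> alt_forms V l" and \<beta>: "\<beta> \<in> alt_forms V l" and l: "l \<le> n"
  shows "wedge l (n - l) \<beta> (form_contract l \<alpha> vol) (map e [0..<n]) = form_metric V g l \<beta> \<alpha>"
proof -
  have "(\<Sum>J\<in>index_lists n (n - l). vol (map e (I @ J)) * (\<beta> (map e I) * form_contract l \<alpha> vol (map e J))) =
      fact (n - l) * (\<beta> (map e I) * \<alpha> (map e I))" if I: "I \<in> index_lists n l" for I
  proof (cases "distinct I")
    case False
    then have "\<beta> (map e I) = 0"
      by (intro alt_forms_not_distinct[OF \<beta>]) (simp add: distinct_map)
    then show ?thesis
      by simp
  next
    case True
    have "vol (map e (I @ J)) * (\<beta> (map e I) * form_contract l \<alpha> vol (map e J)) =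
        (if distinct (I @ J) then \<beta> (map e I) * \<alpha> (map e I) else 0)"
      if J: "J \<in> index_lists n (n - l)" for J
    proof (cases "distinct (I @ J)")
      case True
      then show ?thesis
        using form_contract_vol_apply[OF \<alpha> l I J] vol_sq[of "I @ J"] append_index_lists[OF I J] l
        by (simp del: map_append distinct_append add: mult_ac)
    qed (use vol_not_distinct in \<open>simp del: map_append distinct_append\<close>)
    then have "(\<Sum>J\<in>index_lists n (n - l). vol (map e (I @ J)) *
        (\<beta> (map e I) * form_contract l \<alpha> vol (map e J))) =
        (\<Sum>J\<in>{J \<in> index_lists n (n - l). distinct (I @ J)}. \<beta> (map e I) * \<alpha> (map e I))"
      by (simp add: sum.inter_filter del: map_append distinct_append sum_constant)
    then show ?thesis
      using card_complement[OF I True l] by simp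
  qed
  then show ?thesis
    unfolding wedge_basis[OF l] form_metric_eq[OF \<beta> \<alpha>]
    by (simp flip: sum_distrib_left del: map_append)
qed

text \<open>
  Testing against \<open>\<beta> = \<star>\<gamma>\<close> gives, up to sign, the sum of the squares of the components of \<open>\<gamma>\<close>.
\<close>

lemma wedge_nondegenerate:
  assumes \<gamma>: "\<gamma> \<in> alt_forms V (n - l)" and l: "l \<le> n"
    and 0: "\<And>\<beta>. \<beta> \<in> alt_forms V l \<Longrightarrow> wedge l (n - l) \<beta> \<gamma> (map e [0..<n]) = 0"
  shows "\<gamma> = 0"
proof (rule alt_forms_eqI[OF \<gamma> zero_in_alt_forms])
  let ?\<beta> = "form_contract (n - l) \<gamma> vol"
  let ?s = "(-1::real) ^ (l * (n - l))"
  let ?v = "\<lambda>I J. vol (map e (I @ J)) ^ 2 * \<gamma> (map e J) ^ 2"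
  have "?\<beta> \<in> alt_forms V l"
    using form_contract_in_alt_forms[OF vol_in_alt_forms, of "n - l" \<gamma>] l by simp
  then have "(\<Sum>I\<in>index_lists n l. \<Sum>J\<in>index_lists n (n - l).
       vol (map e (I @ J)) * (?\<beta> (map e I) * \<gamma> (map e J))) = 0"
    using 0[of ?\<beta>] by (simp add: wedge_basis[OF l] del: map_append)
  moreover have "vol (map e (I @ J)) * (?\<beta> (map e I) * \<gamma> (map e J)) = ?s * ?v I J"
    if I: "I \<in> index_lists n l" and J: "J \<in> index_lists n (n - l)" for I J
  proof (cases "distinct (I @ J)")
    case True
    then have "?\<beta> (map e I) = \<gamma> (map e J) * vol (map e (J @ I))"
      using I l by (intro form_contract_vol_apply[OF \<gamma> _ J]) auto
    then show ?thesis
      unfolding vol_swap[OF I J] by (simp add: power2_eq_square mult_ac del: map_append)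
  qed (use vol_not_distinct in \<open>simp del: map_append distinct_append\<close>)
  ultimately have "?s * (\<Sum>I\<in>index_lists n l. \<Sum>J\<in>index_lists n (n - l). ?v I J) = 0"
    by (simp add: sum_distrib_left del: map_append)
  then have sum0: "(\<Sum>I\<in>index_lists n l. \<Sum>J\<in>index_lists n (n - l). ?v I J) = 0"
    by simp
  fix J
  assume J: "J \<in> index_lists n (n - l)" and d: "distinct J"
  \<comment> \<open>For a complementary \<open>I\<close> the component of \<open>vol\<close> is
    nonzero, so the vanishing of this one summand forces the component of \<gamma> to
    vanish.\<close>
  obtain I where I: "I \<in> index_lists n l" "distinct (J @ I)"
    using ex_complement[OF J d] l by auto
  have "?v I J = 0"
    using sum0 I J
    by (simp add: sum_nonneg_eq_0_iff sum_nonneg del: map_append power_eq_0_iff mult_eq_0_iff)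
  moreover have "vol (map e (I @ J)) \<noteq> 0"
    using vol_sq[of "I @ J"] append_index_lists[OF I(1) J] I l by (auto simp: Int_commute)
  ultimately show "\<gamma> (map e J) = 0 (map e J)"
    by simp
qed

text \<open>Existence is \<open>wedge_star_basis\<close>, spread from one basis to all arguments
  because top forms are multiples of \<open>vol\<close>; uniqueness applies
  \<open>wedge_nondegenerate\<close> to a difference. For \<open>l > n\<close> the sum evaluates
  \<open>vol\<close> on lists that are too long, which matches the default value 0.\<close>

lemma star_eq:
  assumes vf: "volume_form V g P n = vol" and \<alpha>: "\<alpha> \<in> alt_forms V l"
  shows "star V g P n l \<alpha> = form_contract l \<alpha> vol"
proof (cases "l \<le> n")
  case True
  let ?E = "map e [0..<n]"
  have top: "wedge l (n - l) \<beta> \<gamma> \<in> alt_forms V n"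
    if "\<beta> \<in> alt_forms V l" "\<gamma> \<in> alt_forms V (n - l)" for \<beta> \<gamma>
    using wedge_in_alt_forms[OF subspace that] True by simp
  have star: "form_contract l \<alpha> vol \<in> alt_forms V (n - l)"
    by (rule form_contract_in_alt_forms[OF vol_in_alt_forms])
  have "(THE \<gamma>. \<gamma> \<in> alt_forms V (n - l) \<and>
       (\<forall>\<beta>\<in>alt_forms V l. wedge l (n - l) \<beta> \<gamma> = form_metric V g l \<beta> \<alpha> *\<^sub>R vol)) = form_contract l \<alpha> vol"
  proof (rule the_equality)
    show "form_contract l \<alpha> vol \<in> alt_forms V (n - l) \<and> (\<forall>\<beta>\<in>alt_forms V l.
        wedge l (n - l) \<beta> (form_contract l \<alpha> vol) = form_metric V g l \<beta> \<alpha> *\<^sub>R vol)"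
      using star top top_form_eq wedge_star_basis[OF \<alpha> _ True] by metis
    fix \<gamma>
    assume \<gamma>: "\<gamma> \<in> alt_forms V (n - l) \<and>
       (\<forall>\<beta>\<in>alt_forms V l. wedge l (n - l) \<beta> \<gamma> = form_metric V g l \<beta> \<alpha> *\<^sub>R vol)"
    have "\<gamma> - form_contract l \<alpha> vol = 0"
    proof (rule wedge_nondegenerate[OF _ True])
      show "\<gamma> - form_contract l \<alpha> vol \<in> alt_forms V (n - l)"
        using \<gamma> star by (intro subspace_diff subspace_alt_forms) auto
      fix \<beta>
      assume \<beta>: "\<beta> \<in> alt_forms V l"
      have "wedge l (n - l) \<beta> (\<gamma> - form_contract l \<alpha> vol) ?E =
          wedge l (n - l) \<beta> \<gamma> ?E - wedge l (n - l) \<beta> (form_contract l \<alpha> vol) ?E"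
        unfolding wedge_basis[OF True]
        by (simp add: right_diff_distrib sum_subtractf diff_divide_distrib del: map_append)
      then show "wedge l (n - l) \<beta> (\<gamma> - form_contract l \<alpha> vol) ?E = 0"
        using \<gamma> \<beta> by (simp add: wedge_star_basis[OF \<alpha> _ True] vol_basis)
    qed
    then show "\<gamma> = form_contract l \<alpha> vol"
      by simp
  qed
  then show ?thesis
    using True by (simp add: star_def vf)
next
  case False
  have "vol (map e I @ ys) = 0" if "I \<in> index_lists n l" for I ys
    using False index_lists_map(1)[OF that] by (intro alt_forms_outside[OF vol_in_alt_forms]) auto
  then have "form_contract l \<alpha> vol = 0"
    by (intro ext) (simp add: form_contract_def sum_fun_apply)
  then show ?thesis
    using False by (simp add: star_def)
qed

text \<open>For a complement \<open>J\<close> of \<open>I\<close>, the two contractions bring in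
  \<open>vol\<close> on \<open>I @ J\<close> and on \<open>J @ I\<close>. Their product is the sign
  of exchanging the blocks.\<close>

lemma form_contract_vol_twice:
  assumes \<alpha>: "\<alpha> \<in> alt_forms V l" and l: "l \<le> n"
  shows "form_contract (n - l) (form_contract l \<alpha> vol) vol = (-1) ^ (l * (n - l)) *\<^sub>R \<alpha>"
proof (rule alt_forms_eqI)
  have star: "form_contract l \<alpha> vol \<in> alt_forms V (n - l)"
    by (rule form_contract_in_alt_forms[OF vol_in_alt_forms])
  show "form_contract (n - l) (form_contract l \<alpha> vol) vol \<in> alt_forms V l"
    using form_contract_in_alt_forms[OF vol_in_alt_forms, of "n - l" "form_contract l \<alpha> vol"] l by simp
  show "(-1) ^ (l * (n - l)) *\<^sub>R \<alpha> \<in> alt_forms V l"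
    by (intro subspace_scale subspace_alt_forms \<alpha>)
  fix I
  assume I: "I \<in> index_lists n l" and "distinct I"
  then obtain J where J: "J \<in> index_lists n (n - l)" and d: "distinct (I @ J)"
    by (rule ex_complement)
  have "form_contract (n - l) (form_contract l \<alpha> vol) vol (map e I) =
      form_contract l \<alpha> vol (map e J) * vol (map e (J @ I))"
    using I l d by (intro form_contract_vol_apply[OF star _ J]) auto
  also have "\<dots> = \<alpha> (map e I) * vol (map e (I @ J)) * ((-1) ^ (l * (n - l)) * vol (map e (I @ J)))"
    using form_contract_vol_apply[OF \<alpha> l I J d] vol_swap[OF I J] by simp
  also have "\<dots> = (-1) ^ (l * (n - l)) * \<alpha> (map e I) * (vol (map e (I @ J)) * vol (map e (I @ J)))"
    by simp
  also have "vol (map e (I @ J)) * vol (map e (I @ J)) = 1"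
    using append_index_lists[OF I J] l d by (intro vol_sq) auto
  finally show "form_contract (n - l) (form_contract l \<alpha> vol) vol (map e I) =
      ((-1) ^ (l * (n - l)) *\<^sub>R \<alpha>) (map e I)"
    by simp
qed

text \<open>The sign of each permutation in \<open>wedge\<close> is absorbed by permuting the
  leading arguments of \<phi>; summation over all index lists then makes all permutations contribute
  equally, which cancels \<open>fact (k + l)\<close>. What remains is the order of the blocks: the
  outer contraction by \<beta> fills the slots behind those of \<alpha>, and exchanging the two
  gives the sign.\<close>

lemma form_contract_wedge:
  assumes \<phi>: "\<phi> \<in> alt_forms V m"
  shows "form_contract k \<beta> (form_contract l \<alpha> \<phi>) =
    (-1) ^ (k * l) *\<^sub>R form_contract (k + l) (wedge k l \<beta> \<alpha>) \<phi>"
proof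
  fix ys
  let ?P = "{\<pi>. \<pi> permutes {..<k + l}}"
  define h where "h K = \<beta> (map e (take k K)) * \<alpha> (map e (drop k K)) * \<phi> (map e K @ ys)" for K
  have "wedge k l \<beta> \<alpha> (map e K) * \<phi> (map e K @ ys) = (\<Sum>\<pi>\<in>?P. h (permute_list \<pi> K)) / (fact k * fact l)"
    if K: "K \<in> index_lists n (k + l)" for K
  proof -
    have len: "length K = k + l"
      using K by (simp add: index_lists_def)
    have "of_int (sign \<pi>) * (\<beta> (take k (permute_list \<pi> (map e K))) * \<alpha> (drop k (permute_list \<pi> (map e K)))) *
        \<phi> (map e K @ ys) = h (permute_list \<pi> K)" if \<pi>: "\<pi> permutes {..<k + l}" for \<pi>
    proof -
      have "\<phi> (map e (permute_list \<pi> K) @ ys) = of_int (sign \<pi>) * \<phi> (map e K @ ys)"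
        using alt_forms_permute[OF subspace alt_forms_suffix[OF \<phi>, of "k + l" ys], of \<pi> "map e K"] \<pi> len
        by (simp add: permute_list_map)
      then show ?thesis
        using \<pi> len by (simp add: h_def permute_list_map take_map drop_map)
    qed
    then show ?thesis
      using len by (simp add: wedge_eq sum_distrib_right)
  qed
  then have "(\<Sum>K\<in>index_lists n (k + l). wedge k l \<beta> \<alpha> (map e K) * \<phi> (map e K @ ys)) =
      (\<Sum>K\<in>index_lists n (k + l). \<Sum>\<pi>\<in>?P. h (permute_list \<pi> K)) / (fact k * fact l)"
    by (simp add: sum_divide_distrib)
  also have "(\<Sum>K\<in>index_lists n (k + l). \<Sum>\<pi>\<in>?P. h (permute_list \<pi> K)) =
      (\<Sum>\<pi>\<in>?P. \<Sum>K\<in>index_lists n (k + l). h K)"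
    by (subst sum.swap) (simp add: sum_index_lists_permute)
  also have "\<dots> = fact (k + l) * (\<Sum>K\<in>index_lists n (k + l). h K)"
    by (simp add: card_permutations)
  finally have "form_contract (k + l) (wedge k l \<beta> \<alpha>) \<phi> ys =
      (\<Sum>K\<in>index_lists n (k + l). h K) / (fact k * fact l)"
    by (simp add: form_contract_def sum_fun_apply flip: sum_divide_distrib)
  also have "(\<Sum>K\<in>index_lists n (k + l). h K) = (\<Sum>I\<in>index_lists n k. \<Sum>J\<in>index_lists n l.
      \<beta> (map e I) * \<alpha> (map e J) * \<phi> (map e I @ map e J @ ys))"
    unfolding sum_index_lists_append by (simp add: h_def index_lists_def)
  also have "\<dots> = (\<Sum>I\<in>index_lists n k. \<Sum>J\<in>index_lists n l.
      (-1) ^ (k * l) * (\<beta> (map e I) * \<alpha> (map e J) * \<phi> (map e J @ map e I @ ys)))"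
  proof (intro sum.cong refl)
    fix I J
    assume "I \<in> index_lists n k" "J \<in> index_lists n l"
    then show "\<beta> (map e I) * \<alpha> (map e J) * \<phi> (map e I @ map e J @ ys) =
        (-1) ^ (k * l) * (\<beta> (map e I) * \<alpha> (map e J) * \<phi> (map e J @ map e I @ ys))"
      using alt_forms_block_swap[OF subspace \<phi>, of "map e I" "map e J" ys] by (simp add: index_lists_def)
  qed
  also have "\<dots> = (-1) ^ (k * l) * (\<Sum>I\<in>index_lists n k. \<Sum>J\<in>index_lists n l.
      \<beta> (map e I) * \<alpha> (map e J) * \<phi> (map e J @ map e I @ ys))"
    by (simp add: sum_distrib_left)
  finally have "((-1) ^ (k * l) *\<^sub>R form_contract (k + l) (wedge k l \<beta> \<alpha>) \<phi>) ys =
      (\<Sum>I\<in>index_lists n k. \<Sum>J\<in>index_lists n l.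
        \<beta> (map e I) * \<alpha> (map e J) * \<phi> (map e J @ map e I @ ys)) / (fact k * fact l)"
    by (simp flip: power_mult_distrib mult.assoc)
  then show "form_contract k \<beta> (form_contract l \<alpha> \<phi>) ys =
      ((-1) ^ (k * l) *\<^sub>R form_contract (k + l) (wedge k l \<beta> \<alpha>) \<phi>) ys"
    by (simp add: form_contract_def sum_fun_apply sum_distrib_left sum_divide_distrib mult_ac)
qed

end

section \<open>The identities on a single tangent space\<close>

text \<open>Integer powers occur because the exponents can be negative in degenerate degrees; sign
  comparisons below reduce to parity.\<close>

lemma minus_one_powi: "(- 1::real) powi k = (if even k then 1 else - 1)"
  by (simp add: power_int_minus_left)

lemma minus_one_power: "(- 1::real) ^ k = (if even k then 1 else - 1)"
  by simp

context orthonormal_basis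
begin

lemma star_in_alt_forms:
  assumes "volume_form V g P n = vol" "\<alpha> \<in> alt_forms V l"
  shows "star V g P n l \<alpha> \<in> alt_forms V (n - l)"
  by (simp add: star_eq[OF assms] form_contract_in_alt_forms[OF vol_in_alt_forms])

lemma star_zero:
  assumes "volume_form V g P n = vol"
  shows "star V g P n l 0 = 0"
  using star_eq[OF assms zero_in_alt_forms, of l] by (simp add: form_contract_def)

lemma star_scaleR:
  assumes "volume_form V g P n = vol" "\<alpha> \<in> alt_forms V l"
  shows "star V g P n l (c *\<^sub>R \<alpha>) = c *\<^sub>R star V g P n l \<alpha>"
  using assms subspace_scale[OF subspace_alt_forms assms(2), of c]
  by (simp add: star_eq form_contract_def scaleR_sum_right)

lemma star_star:
  assumes "volume_form V g P n = vol" "\<alpha> \<in> alt_forms V l" "l \<le> n"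
  shows "star V g P n (n - l) (star V g P n l \<alpha>) = (-1) ^ (l * (n - l)) *\<^sub>R \<alpha>"
  using assms star_in_alt_forms[OF assms(1,2)]
  by (simp add: star_eq[OF assms(1)] form_contract_vol_twice)

lemma contract_scaleR:
  assumes "Q \<in> multivectors V q" "\<phi> \<in> alt_forms V m"
  shows "contract V q Q (c *\<^sub>R \<phi>) = c *\<^sub>R contract V q Q \<phi>"
proof -
  have "(\<lambda>ys. (c *\<^sub>R \<phi>) (xs @ ys)) = c *\<^sub>R (\<lambda>ys. \<phi> (xs @ ys))" for xs
    by (simp add: fun_eq_iff)
  then show ?thesis
    using contract_eq[OF assms] contract_eq[OF assms(1) subspace_scale[OF subspace_alt_forms assms(2)], of c]
    by (simp add: form_contract_def scaleR_sum_right mult.commute)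
qed

lemma contract_zero: "Q \<in> multivectors V q \<Longrightarrow> contract V q Q 0 = 0"
  using contract_scaleR[of Q q 0 0 0] by simp

lemma contract_above_degree:
  assumes "Q \<in> multivectors V q" "\<phi> \<in> alt_forms V m" "m < q"
  shows "contract V q Q \<phi> = 0"
proof -
  have "\<phi> (map e I @ ys) = 0" if "I \<in> index_lists n q" for I ys
    using assms(3) index_lists_map(1)[OF that] by (intro alt_forms_outside[OF assms(2)]) auto
  then show ?thesis
    by (intro ext) (simp add: contract_eq[OF assms(1,2)] form_contract_def sum_fun_apply)
qed

lemma wedge_zero_right: "wedge k l \<beta> 0 = 0"
  by (rule ext) (simp add: wedge_def)

context
  fixes P Q q l \<alpha>
  assumes vf: "volume_form V g P n = vol"
    and Q: "Q \<in> multivectors V q"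
    and \<alpha>: "\<alpha> \<in> alt_forms V l"
begin

lemma wedge_flat_form: "wedge q l (flat V g q Q) \<alpha> \<in> alt_forms V (q + l)"
  by (rule wedge_in_alt_forms[OF subspace flat_in_alt_forms[OF Q] \<alpha>])

lemma wedge_flat_star:
  "wedge q (n - l) (flat V g q Q) (star V g P n l \<alpha>) \<in> alt_forms V (q + (n - l))"
  by (rule wedge_in_alt_forms[OF subspace flat_in_alt_forms[OF Q] star_in_alt_forms[OF vf \<alpha>]])

text \<open>Both stars become contractions of \<open>vol\<close>, and the sign is that of
  \<open>form_contract_wedge\<close>. Since \<open>star_eq\<close> holds in every degree, this
  includes \<open>q + l > n\<close>.\<close>

lemma contract_star:
  "contract V q Q (star V g P n l \<alpha>) =
     (- 1) ^ (l * q) *\<^sub>R star V g P n (q + l) (wedge q l (flat V g q Q) \<alpha>)"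
  using form_contract_wedge[OF vol_in_alt_forms, of q "flat V g q Q" l \<alpha>]
  unfolding contract_eq[OF Q star_in_alt_forms[OF vf \<alpha>]] star_eq[OF vf wedge_flat_form]
  by (simp add: star_eq[OF vf \<alpha>] mult.commute)

end

text \<open>The context is closed and reopened with the same data so that
  \<open>contract_star\<close> becomes available for other forms, in particular for the star of
  \<alpha> in degree \<open>n - l\<close>.\<close>

context
  fixes P Q q l \<alpha>
  assumes vf: "volume_form V g P n = vol"
    and Q: "Q \<in> multivectors V q"
    and \<alpha>: "\<alpha> \<in> alt_forms V l"
begin

lemma contract_eq_star:
  "contract V q Q \<alpha> = (- 1) powi ((int l - int q) * (int n - int l)) *\<^sub>R
     star V g P n (q + (n - l)) (wedge q (n - l) (flat V g q Q) (star V g P n l \<alpha>))"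
proof (cases "l \<le> n")
  case True
  have "(-1) ^ (l * (n - l)) *\<^sub>R contract V q Q \<alpha> =
      contract V q Q (star V g P n (n - l) (star V g P n l \<alpha>))"
    by (simp only: star_star[OF vf \<alpha> True] contract_scaleR[OF Q \<alpha>])
  also have "\<dots> = (- 1) ^ ((n - l) * q) *\<^sub>R
      star V g P n (q + (n - l)) (wedge q (n - l) (flat V g q Q) (star V g P n l \<alpha>))"
    by (rule contract_star[OF vf Q star_in_alt_forms[OF vf \<alpha>]])
  finally have "(-1) ^ (l * (n - l)) *\<^sub>R (-1) ^ (l * (n - l)) *\<^sub>R contract V q Q \<alpha> =
      (-1) ^ (l * (n - l)) *\<^sub>R (- 1) ^ ((n - l) * q) *\<^sub>R
        star V g P n (q + (n - l)) (wedge q (n - l) (flat V g q Q) (star V g P n l \<alpha>))"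
    by simp
  then have "contract V q Q \<alpha> = ((-1) ^ (l * (n - l)) * (- 1) ^ ((n - l) * q)) *\<^sub>R
        star V g P n (q + (n - l)) (wedge q (n - l) (flat V g q Q) (star V g P n l \<alpha>))"
    by (simp flip: power_mult_distrib)
  \<comment> \<open>Modulo 2, \<open>l * (n - l) + (n - l) * q\<close> is
    \<open>(l - q) * (n - l)\<close>.\<close>
  also have "(-1::real) ^ (l * (n - l)) * (- 1) ^ ((n - l) * q) =
      (- 1) powi ((int l - int q) * (int n - int l))"
    using True by (auto simp: minus_one_powi minus_one_power)
  finally show ?thesis .
next
  case False
  then have "\<alpha> = 0"
    using alt_forms_above_dim[OF \<alpha>] by simp
  then show ?thesis
    by (simp add: contract_zero[OF Q] star_zero[OF vf] wedge_zero_right)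
qed

lemma star_contract:
  "star V g P n (l - q) (contract V q Q \<alpha>) =
     (- 1) powi (int q * (int l - int q)) *\<^sub>R
       wedge q (n - l) (flat V g q Q) (star V g P n l \<alpha>)"
proof -
  let ?W = "wedge q (n - l) (flat V g q Q) (star V g P n l \<alpha>)"
  note W = wedge_flat_star[OF vf Q \<alpha>]
  consider "n < l" | "l \<le> n" "l < q" | "l \<le> n" "q \<le> l"
    by linarith
  then show ?thesis
  proof cases
    case 1
    then have "\<alpha> = 0"
      using alt_forms_above_dim[OF \<alpha>] by simp
    then show ?thesis
      by (simp add: contract_zero[OF Q] star_zero[OF vf] wedge_zero_right)
  next
    case 2
    \<comment> \<open>The wedge has degree \<open>q + (n - l) > n\<close>, while the left side
      contracts beyond the degree of \<alpha>.\<close>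
    then have "?W = 0"
      by (intro alt_forms_above_dim[OF W]) simp
    then show ?thesis
      using 2 by (simp add: contract_above_degree[OF Q \<alpha>] star_zero[OF vf])
  next
    case 3
    let ?k = "q + (n - l)"
    have k: "?k \<le> n" "n - ?k = l - q"
      using 3 by auto
    have "star V g P n (l - q) (contract V q Q \<alpha>) =
        (- 1) powi ((int l - int q) * (int n - int l)) *\<^sub>R star V g P n (n - ?k) (star V g P n ?k ?W)"
      using star_scaleR[OF vf star_in_alt_forms[OF vf W]] by (simp add: contract_eq_star k)
    also have "\<dots> = ((- 1) powi ((int l - int q) * (int n - int l)) * (- 1) ^ (?k * (n - ?k))) *\<^sub>R ?W"
      by (simp add: star_star[OF vf W k(1)])
    \<comment> \<open>Modulo 2, \<open>(l - q) * (n - l) + (q + n - l) * (l - q)\<close> is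
      \<open>q * (l - q)\<close>.\<close>
    also have "(- 1) powi ((int l - int q) * (int n - int l)) * (- 1) ^ (?k * (n - ?k)) =
        ((- 1) powi (int q * (int l - int q)) :: real)"
      using 3 unfolding k by (auto simp: minus_one_powi minus_one_power)
    finally show ?thesis .
  qed
qed

lemma star_contract_star:
  "star V g P n (n - l - q) (contract V q Q (star V g P n l \<alpha>)) =
     (- 1) powi (int q * (int n - int l - int q) + int l * (int n - int l)) *\<^sub>R
       wedge q l (flat V g q Q) \<alpha>"
proof (cases "q + l \<le> n")
  case True
  let ?W = "wedge q l (flat V g q Q) \<alpha>"
  note W = wedge_flat_form[OF vf Q \<alpha>]
  have k: "n - l - q = n - (q + l)"
    by simp
  have "star V g P n (n - l - q) (contract V q Q (star V g P n l \<alpha>)) =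
      (- 1) ^ (l * q) *\<^sub>R star V g P n (n - (q + l)) (star V g P n (q + l) ?W)"
    unfolding k contract_star[OF vf Q \<alpha>] by (rule star_scaleR[OF vf star_in_alt_forms[OF vf W]])
  also have "\<dots> = ((- 1) ^ (l * q) * (- 1) ^ ((q + l) * (n - (q + l)))) *\<^sub>R ?W"
    by (simp add: star_star[OF vf W True])
  \<comment> \<open>Modulo 2, the term \<open>l * q\<close> cancels the one split off from
    \<open>l * (n - q - l)\<close>.\<close>
  also have "(- 1::real) ^ (l * q) * (- 1) ^ ((q + l) * (n - (q + l))) =
      (- 1) powi (int q * (int n - int l - int q) + int l * (int n - int l))"
    using True by (auto simp: minus_one_powi minus_one_power)
  finally show ?thesis .
next
  case False
  then have "wedge q l (flat V g q Q) \<alpha> = 0"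
    by (intro alt_forms_above_dim[OF wedge_flat_form[OF vf Q \<alpha>]]) simp
  then show ?thesis
    by (simp add: contract_star[OF vf Q \<alpha>] star_zero[OF vf])
qed

end

end

section \<open>Existence of positively oriented orthonormal bases\<close>

definition orthonormal_family ::
  "'v::real_vector set \<Rightarrow> ('v \<Rightarrow> 'v \<Rightarrow> real) \<Rightarrow> (nat \<Rightarrow> 'v) \<Rightarrow> nat \<Rightarrow> bool" where
  "orthonormal_family V g e k \<longleftrightarrow> (\<forall>i<k. e i \<in> V) \<and>
     (\<forall>i<k. \<forall>j<k. g (e i) (e j) = (if i = j then 1 else 0))"

locale inner_product_on =
  fixes V :: "'v::real_vector set" and g :: "'v \<Rightarrow> 'v \<Rightarrow> real"
  assumes subspace: "subspace V"
    and linear: "u \<in> V \<Longrightarrow> v \<in> V \<Longrightarrow> w \<in> V \<Longrightarrow> g (a *\<^sub>R u + b *\<^sub>R v) w = a * g u w + b * g v w"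
    and sym: "u \<in> V \<Longrightarrow> v \<in> V \<Longrightarrow> g u v = g v u"
    and pos: "u \<in> V \<Longrightarrow> u \<noteq> 0 \<Longrightarrow> g u u > 0"
begin

lemma sum_left:
  assumes "\<And>i. i \<in> S \<Longrightarrow> x i \<in> V" "w \<in> V"
  shows "g (\<Sum>i\<in>S. c i *\<^sub>R x i) w = (\<Sum>i\<in>S. c i * g (x i) w)"
proof -
  have "g 0 w = 0"
    using linear[of 0 0 w 0 0] assms(2) subspace by (simp add: subspace_0)
  then show ?thesis
    using assms(1)
  proof (induction S rule: infinite_finite_induct)
    case (insert i S)
    have "(\<Sum>i\<in>S. c i *\<^sub>R x i) \<in> V"
      using subspace insert.prems by (auto intro!: subspace_sum subspace_scale)
    then show ?case
      using insert linear[of "x i" "\<Sum>i\<in>S. c i *\<^sub>R x i" w "c i" 1] assms(2) by simp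
  qed simp_all
qed

lemma orthonormal_family_sum:
  assumes "orthonormal_family V g e k" "j < k"
  shows "g (\<Sum>i<k. c i *\<^sub>R e i) (e j) = c j"
proof -
  have "g (\<Sum>i<k. c i *\<^sub>R e i) (e j) = (\<Sum>i<k. c i * g (e i) (e j))"
    using assms by (intro sum_left) (auto simp: orthonormal_family_def)
  also have "\<dots> = (\<Sum>i<k. if i = j then c i else 0)"
    using assms by (intro sum.cong) (auto simp: orthonormal_family_def)
  finally have "g (\<Sum>i<k. c i *\<^sub>R e i) (e j) = (\<Sum>i<k. if i = j then c i else 0)" .
  then show ?thesis
    using assms(2) by simp
qed

lemma orthonormal_family_independent:
  assumes "orthonormal_family V g e k"
  shows "inj_on e {..<k}" "independent (e ` {..<k})"
proof -
  show inj: "inj_on e {..<k}"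
  proof (rule inj_onI)
    fix i j
    assume "i \<in> {..<k}" "j \<in> {..<k}" "e i = e j"
    then show "i = j"
      using assms unfolding orthonormal_family_def by (metis lessThan_iff zero_neq_one)
  qed
  show "independent (e ` {..<k})"
  proof (rule independent_if_scalars_zero)
    fix c v
    assume 0: "(\<Sum>v\<in>e ` {..<k}. c v *\<^sub>R v) = 0" and "v \<in> e ` {..<k}"
    then obtain j where j: "j < k" "v = e j"
      by auto
    have "g (\<Sum>i<k. c (e i) *\<^sub>R e i) (e j) = g 0 (e j)"
      using 0 by (simp add: sum.reindex[OF inj])
    moreover have "g 0 (e j) = 0"
      using sum_left[of "{}" undefined "e j"] assms j by (simp add: orthonormal_family_def)
    ultimately show "c v = 0"
      using orthonormal_family_sum[OF assms j(1)] j by simp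
  qed simp
qed

text \<open>The residual of a vector that fails its expansion is nonzero and orthogonal to the
  family. Read contrapositively, a family that cannot be lengthened already gives the expansion
  formula.\<close>

lemma orthonormal_family_extend:
  assumes e: "orthonormal_family V g e k" and x: "x \<in> V" and ne: "x \<noteq> (\<Sum>i<k. g x (e i) *\<^sub>R e i)"
  shows "\<exists>e'. orthonormal_family V g e' (Suc k)"
proof -
  let ?s = "\<Sum>i<k. g x (e i) *\<^sub>R e i"
  define w where "w = x - ?s"
  define u where "u = (1 / sqrt (g w w)) *\<^sub>R w"
  have eV: "e i \<in> V" if "i < k" for i
    using e that by (simp add: orthonormal_family_def)
  have s: "?s \<in> V"
    using subspace eV by (auto intro!: subspace_sum subspace_scale)
  have w: "w \<in> V" "w \<noteq> 0"
    using subspace x s ne by (simp_all add: w_def subspace_diff)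
  have u: "u \<in> V"
    using subspace w by (simp add: u_def subspace_scale)
  have scale: "g (c *\<^sub>R y) z = c * g y z" if "y \<in> V" "z \<in> V" for c y z
    using linear[of y y z c 0] that by simp
  have "g w w > 0"
    using pos w by simp
  then have uu: "g u u = 1"
    using scale[OF w(1) u] scale[OF w(1) w(1)] sym[OF w(1) u] by (simp add: u_def)
  have "g w (e j) = 0" if "j < k" for j
    using linear[OF x s eV[OF that], of 1 "-1"] orthonormal_family_sum[OF e that] by (simp add: w_def)
  then have ue: "g u (e j) = 0" "g (e j) u = 0" if "j < k" for j
    using scale[OF w(1) eV[OF that]] sym[OF eV[OF that] u] that by (simp_all add: u_def)
  have "orthonormal_family V g (e(k := u)) (Suc k)"
    using e u uu ue by (auto simp: orthonormal_family_def less_Suc_eq)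
  then show ?thesis
    by blast
qed

text \<open>The dimension of \<open>V\<close>, a mere subset of its type, is measured through the
  linear isomorphism \<open>f\<close>; for tangent spaces \<open>f\<close> is
  \<open>coord_vector\<close>.\<close>

lemma ex_orthonormal_basis:
  fixes f :: "'e::euclidean_space \<Rightarrow> 'v"
  assumes f: "Real_Vector_Spaces.linear f" "inj f" "range f = V"
  shows "\<exists>e. orthonormal_basis V g e DIM('e)"
proof -
  let ?B = "f ` Basis"
  have V: "V = span ?B"
    using f linear_span_image[OF f(1), of Basis] by simp
  have card: "card ?B = DIM('e)"
    using f by (simp add: card_image inj_on_subset)
  have indep: "independent ?B"
    using linear_independent_injective_image[OF f(1) independent_Basis] f(2) by (simp add: inj_on_subset)
  have bound: "k \<le> DIM('e)" if e: "orthonormal_family V g e k" for e k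
  proof -
    have "e ` {..<k} \<subseteq> span ?B"
      using e V by (auto simp: orthonormal_family_def)
    then have "card (e ` {..<k}) \<le> card ?B"
      using independent_span_bound[OF _ orthonormal_family_independent(2)[OF e], of ?B] by simp
    then show ?thesis
      using card orthonormal_family_independent(1)[OF e] by (simp add: card_image)
  qed
  have "\<exists>e. orthonormal_family V g e k" if "k \<le> DIM('e)" for k
    using that
  proof (induction k)
    case (Suc k)
    then obtain e where e: "orthonormal_family V g e k"
      by auto
    show ?case
    proof (cases "\<exists>x\<in>V. x \<noteq> (\<Sum>i<k. g x (e i) *\<^sub>R e i)")
      \<comment> \<open>If every expansion already holds with \<open>k\<close> vectors, they span
        \<open>V\<close>, which is impossible because \<open>V\<close> contains
        \<open>DIM('e)\<close> independent vectors and \<open>k\<close> is smaller.\<close>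
      case False
      have "V \<subseteq> span (e ` {..<k})"
      proof
        fix x
        assume "x \<in> V"
        then have "x = (\<Sum>i<k. g x (e i) *\<^sub>R e i)"
          using False by blast
        also have "\<dots> \<in> span (e ` {..<k})"
          by (intro span_sum span_scale span_base) auto
        finally show "x \<in> span (e ` {..<k})" .
      qed
      then have "card ?B \<le> card (e ` {..<k})"
        using independent_span_bound[OF _ indep, of "e ` {..<k}"] f(3) by auto
      also have "\<dots> \<le> k"
        using card_image_le[of "{..<k}" e] by simp
      finally show ?thesis
        using Suc.prems card by simp
    qed (use orthonormal_family_extend[OF e] in blast)
  qed (simp add: orthonormal_family_def)
  then obtain e where e: "orthonormal_family V g e DIM('e)"
    by blast
  \<comment> \<open>A failing expansion would produce an orthonormal family longer than
    \<open>bound\<close> permits.\<close>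
  have "x = (\<Sum>i<DIM('e). g x (e i) *\<^sub>R e i)" if "x \<in> V" for x
    using orthonormal_family_extend[OF e that] bound by fastforce
  then have "orthonormal_basis V g e DIM('e)"
    using e subspace linear sym by unfold_locales (auto simp: orthonormal_family_def)
  then show ?thesis
    by blast
qed

end

text \<open>Negating \<open>e 0\<close> keeps orthonormality and the expansion and flips the sign of
  a top form; \<open>n > 0\<close> provides the vector to negate.\<close>

lemma (in orthonormal_basis) ex_positive_basis:
  assumes \<mu>: "\<mu> \<in> alt_forms V n" "\<mu> \<noteq> 0" and n: "n > 0"
  shows "\<exists>e'. orthonormal_basis V g e' n \<and> \<mu> (map e' [0..<n]) > 0"
proof (cases "\<mu> (map e [0..<n]) > 0")
  case True
  then show ?thesis
    using orthonormal_basis_axioms by blast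
next
  case False
  let ?E = "map e [0..<n]"
  let ?e = "e(0 := - e 0)"
  have "\<mu> ?E \<noteq> 0"
    using top_form_eq[OF \<mu>(1)] \<mu>(2) by auto
  then have neg: "\<mu> ?E < 0"
    using False by simp
  have e0: "e 0 \<in> V" "- e 0 \<in> V"
    using basis_in n subspace by (auto simp: subspace_neg)
  have neg_left: "g (- e 0) y = - g (e 0) y" if "y \<in> V" for y
    using metric_linear[OF e0(1) e0(1) that, of "-1" 0] by simp
  have neg_right: "g y (- e 0) = - g y (e 0)" if "y \<in> V" for y
    using neg_left[OF that] metric_sym[OF that] e0 by simp
  have "orthonormal_basis V g ?e n"
  proof
    show "?e i \<in> V" if "i < n" for i
      using that e0 basis_in by simp
    show "g (?e i) (?e j) = (if i = j then 1 else 0)" if "i < n" "j < n" for i j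
      using that e0 basis_in orthonormal by (simp add: neg_left neg_right)
    show "x = (\<Sum>i<n. g x (?e i) *\<^sub>R ?e i)" if "x \<in> V" for x
    proof -
      have "(\<Sum>i<n. g x (?e i) *\<^sub>R ?e i) = (\<Sum>i<n. g x (e i) *\<^sub>R e i)"
        by (rule sum.cong) (use that neg_right in auto)
      then show ?thesis
        using expansion[OF that] by simp
    qed
  qed (use subspace metric_linear metric_sym in auto)
  moreover have "map ?e [0..<n] = ?E[0 := (-1) *\<^sub>R e 0 + 0 *\<^sub>R e 0]"
    by (rule nth_equalityI) (auto simp: nth_list_update)
  moreover have "\<mu> (?E[0 := (-1) *\<^sub>R e 0 + 0 *\<^sub>R e 0]) = - \<mu> ?E"
  proof -
    have "?E[0 := e 0] = ?E"
      by (rule nth_equalityI) (auto simp: nth_list_update)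
    then show ?thesis
      using alt_forms_linear[OF \<mu>(1), of ?E 0 "e 0" "e 0" "-1" 0] index_lists_map(2)[OF upt_index_list] n e0
      by simp
  qed
  ultimately show ?thesis
    using neg by (intro exI[of _ ?e]) simp
qed

section \<open>Tangent spaces\<close>

context
  fixes A :: "('m::{t2_space, second_countable_topology}, 'e::euclidean_space) chart set"
  assumes A: "smooth_atlas A"
begin

section \<open>Derivatives of transition maps\<close>

lemma chart_inv_apply: "c \<in> A \<Longrightarrow> p \<in> fst c \<Longrightarrow> chart_inv c (snd c p) = p"
  using A unfolding smooth_atlas_def by (metis homeomorphism_apply1)

lemma transition_differentiable:
  assumes "c \<in> A" "d \<in> A" "p \<in> fst c" "p \<in> fst d"
  shows "(snd d \<circ> chart_inv c) differentiable (at (snd c p))"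
proof -
  have "smooth_on (snd c ` (fst c \<inter> fst d)) (snd d \<circ> chart_inv c)"
    using A assms unfolding smooth_atlas_def by blast
  then have "Ck_on (Suc 0) (snd c ` (fst c \<inter> fst d)) (snd d \<circ> chart_inv c)"
    unfolding smooth_on_def by blast
  then show ?thesis
    using assms by simp
qed

lemma open_chart_image:
  assumes "c \<in> A" "d \<in> A"
  shows "open (snd c ` (fst c \<inter> fst d))"
proof -
  have "homeomorphism (fst c) (snd c ` fst c) (snd c) (chart_inv c)" "open (snd c ` fst c)" "open (fst d)"
    using A assms unfolding smooth_atlas_def by blast+
  then show ?thesis
    using homeomorphism_imp_open_map[of "fst c" "snd c ` fst c" "snd c" "chart_inv c" "fst c \<inter> fst d"]
    by (metis openin_open_Int openin_open_trans)
qed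

text \<open>Chain rule. The composite is compared with the direct transition map on the image of the
  overlap of \<open>c\<close> and \<open>d\<close>, whose openness lets the derivative be
  transferred.\<close>

lemma transition_chain:
  assumes "c \<in> A" "d \<in> A" "d' \<in> A" "p \<in> fst c" "p \<in> fst d" "p \<in> fst d'"
  shows "frechet_derivative (snd d' \<circ> chart_inv c) (at (snd c p)) u =
    frechet_derivative (snd d' \<circ> chart_inv d) (at (snd d p))
      (frechet_derivative (snd d \<circ> chart_inv c) (at (snd c p)) u)"
proof -
  let ?S = "snd d \<circ> chart_inv c" and ?T = "snd d' \<circ> chart_inv d"
  let ?S' = "frechet_derivative ?S (at (snd c p))" and ?T' = "frechet_derivative ?T (at (snd d p))"
  have S: "(?S has_derivative ?S') (at (snd c p))"
    using transition_differentiable[of c d p] assms frechet_derivative_works by blast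
  have "(?T has_derivative ?T') (at (snd d p))"
    using transition_differentiable[of d d' p] assms frechet_derivative_works by blast
  then have T: "(?T has_derivative ?T') (at (?S (snd c p)))"
    using assms by (simp add: chart_inv_apply)
  have "((?T \<circ> ?S) has_derivative (?T' \<circ> ?S')) (at (snd c p))"
    by (rule diff_chain_at[OF S T])
  then have "((snd d' \<circ> chart_inv c) has_derivative (?T' \<circ> ?S')) (at (snd c p))"
  proof (rule has_derivative_transform_within_open[OF _ open_chart_image[OF assms(1,2)]])
    show "snd c p \<in> snd c ` (fst c \<inter> fst d)"
      using assms by simp
    show "(?T \<circ> ?S) y = (snd d' \<circ> chart_inv c) y" if "y \<in> snd c ` (fst c \<inter> fst d)" for y
      using that assms by (auto simp: chart_inv_apply)
  qed
  then show ?thesis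
    using frechet_derivative_at by (metis comp_apply)
qed

lemma transition_self:
  assumes "c \<in> A" "p \<in> fst c"
  shows "frechet_derivative (snd c \<circ> chart_inv c) (at (snd c p)) u = u"
proof -
  have "(id has_derivative id) (at (snd c p))"
    by simp
  then have "((snd c \<circ> chart_inv c) has_derivative id) (at (snd c p))"
  proof (rule has_derivative_transform_within_open[OF _ open_chart_image[OF assms(1,1)]])
    show "id y = (snd c \<circ> chart_inv c) y" if "y \<in> snd c ` (fst c \<inter> fst c)" for y
      using that assms by (auto simp: chart_inv_apply)
  qed (use assms in auto)
  then show ?thesis
    using frechet_derivative_at by (metis id_apply)
qed

lemma linear_transition:
  assumes "c \<in> A" "d \<in> A" "p \<in> fst c" "p \<in> fst d"
  shows "linear (frechet_derivative (snd d \<circ> chart_inv c) (at (snd c p)))"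
  by (rule linear_frechet_derivative[OF transition_differentiable[OF assms]])

lemma subspace_tangent_space: "subspace (tangent_space A p)"
proof (rule subspaceI)
  show "0 \<in> tangent_space A p"
    unfolding tangent_space_def using linear_0[OF linear_transition] by simp
next
  fix v w
  assume v: "v \<in> tangent_space A p" and w: "w \<in> tangent_space A p"
  show "v + w \<in> tangent_space A p"
    unfolding tangent_space_def
  proof (intro CollectI conjI ballI allI impI)
    fix c d
    assume cd: "c \<in> A" "d \<in> A" "p \<in> fst c \<and> p \<in> fst d"
    then have "v d = frechet_derivative (snd d \<circ> chart_inv c) (at (snd c p)) (v c)"
      "w d = frechet_derivative (snd d \<circ> chart_inv c) (at (snd c p)) (w c)"
      using v w unfolding tangent_space_def by blast+
    then show "(v + w) d = frechet_derivative (snd d \<circ> chart_inv c) (at (snd c p)) ((v + w) c)"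
      using linear_add[OF linear_transition[of c d p], of "v c" "w c"] cd by simp
  next
    fix c
    assume c: "\<not> (c \<in> A \<and> p \<in> fst c)"
    then have "v c = 0" "w c = 0"
      using v w unfolding tangent_space_def by blast+
    then show "(v + w) c = 0"
      by simp
  qed
next
  fix a v
  assume v: "v \<in> tangent_space A p"
  show "a *\<^sub>R v \<in> tangent_space A p"
    unfolding tangent_space_def
  proof (intro CollectI conjI ballI allI impI)
    fix c d
    assume cd: "c \<in> A" "d \<in> A" "p \<in> fst c \<and> p \<in> fst d"
    then have "v d = frechet_derivative (snd d \<circ> chart_inv c) (at (snd c p)) (v c)"
      using v unfolding tangent_space_def by blast
    then show "(a *\<^sub>R v) d = frechet_derivative (snd d \<circ> chart_inv c) (at (snd c p)) ((a *\<^sub>R v) c)"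
      using linear_scale[OF linear_transition[of c d p], of a "v c"] cd by simp
  next
    fix c
    assume c: "\<not> (c \<in> A \<and> p \<in> fst c)"
    then have "v c = 0"
      using v unfolding tangent_space_def by blast
    then show "(a *\<^sub>R v) c = 0"
      by simp
  qed
qed

section \<open>Coordinate isomorphism with the model space\<close>

lemma linear_coord_vector:
  assumes "c \<in> A" "p \<in> fst c"
  shows "linear (coord_vector A c p)"
proof (rule linearI)
  show "coord_vector A c p (u + v) = coord_vector A c p u + coord_vector A c p v" for u v
    using linear_add[OF linear_transition[of c _ p]] assms by (intro ext) (simp add: coord_vector_def)
  show "coord_vector A c p (a *\<^sub>R u) = a *\<^sub>R coord_vector A c p u" for a u
    using linear_scale[OF linear_transition[of c _ p]] assms by (intro ext) (simp add: coord_vector_def)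
qed

lemma inj_coord_vector:
  assumes "c \<in> A" "p \<in> fst c"
  shows "inj (coord_vector A c p)"
proof (rule injI)
  fix u v
  assume "coord_vector A c p u = coord_vector A c p v"
  then have "coord_vector A c p u c = coord_vector A c p v c"
    by simp
  then show "u = v"
    using assms by (simp add: coord_vector_def transition_self)
qed

text \<open>A tangent vector is recovered from its coordinates in the single chart \<open>c\<close>;
  conversely \<open>transition_chain\<close> gives the compatibility of all coordinates produced
  from one model vector.\<close>

lemma range_coord_vector:
  assumes "c \<in> A" "p \<in> fst c"
  shows "range (coord_vector A c p) = tangent_space A p"
proof (intro equalityI subsetI)
  fix v
  assume "v \<in> range (coord_vector A c p)"
  then obtain u where v: "v = coord_vector A c p u"
    by blast
  show "v \<in> tangent_space A p"
    unfolding tangent_space_def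
  proof (intro CollectI conjI ballI allI impI)
    fix d d'
    assume "d \<in> A" "d' \<in> A" "p \<in> fst d \<and> p \<in> fst d'"
    then show "v d' = frechet_derivative (snd d' \<circ> chart_inv d) (at (snd d p)) (v d)"
      using transition_chain[of c d d' p u] assms unfolding v coord_vector_def by simp
  qed (auto simp: v coord_vector_def)
next
  fix v
  assume v: "v \<in> tangent_space A p"
  have "v d = coord_vector A c p (v c) d" for d
  proof (cases "d \<in> A \<and> p \<in> fst d")
    case True
    then have "v d = frechet_derivative (snd d \<circ> chart_inv c) (at (snd c p)) (v c)"
      using v assms unfolding tangent_space_def by blast
    then show ?thesis
      using True by (simp add: coord_vector_def)
  next
    case False
    then have "v d = 0"
      using v unfolding tangent_space_def by blast
    then show ?thesis
      using False by (auto simp: coord_vector_def)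
  qed
  then have "v = coord_vector A c p (v c)"
    by (rule ext)
  then show "v \<in> range (coord_vector A c p)"
    by auto
qed

end

text \<open>The orientation is known only through some nowhere vanishing form. Its sign on an
  orthonormal basis at \<open>p\<close> decides whether the basis must be reflected; positivity then
  identifies the volume form with \<open>vol\<close>.\<close>

lemma ex_oriented_orthonormal_basis:
  fixes A :: "('m::{t2_space, second_countable_topology}, 'e::euclidean_space) chart set"
  assumes M: "oriented_riemannian_manifold A g P"
  shows "\<exists>e. orthonormal_basis (tangent_space A p) (g p) e DIM('e) \<and>
    volume_form (tangent_space A p) (g p) (P p) DIM('e) =
      orthonormal_basis.vol (tangent_space A p) (g p) e DIM('e)"
proof -
  let ?V = "tangent_space A p"
  have A: "smooth_atlas A" and g: "riemannian_metric A g" and P: "is_orientation A P"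
    using M by (auto simp: oriented_riemannian_manifold_def)
  obtain c where c: "c \<in> A" "p \<in> fst c"
    using A unfolding smooth_atlas_def by blast
  interpret inner_product_on ?V "g p"
    using subspace_tangent_space[OF A] g unfolding riemannian_metric_def by unfold_locales blast+
  obtain e where "orthonormal_basis ?V (g p) e DIM('e)"
    using ex_orthonormal_basis linear_coord_vector[OF A c] inj_coord_vector[OF A c]
      range_coord_vector[OF A c] by blast
  moreover obtain \<mu> where \<mu>: "\<mu> \<in> differential_forms A DIM('e)" "\<mu> p \<noteq> 0" "P p = {Es. \<mu> p Es > 0}"
    using P unfolding is_orientation_def by blast
  moreover from this have "\<mu> p \<in> alt_forms ?V DIM('e)"
    by (simp add: differential_forms_def)
  ultimately obtain e' where "orthonormal_basis ?V (g p) e' DIM('e)" "\<mu> p (map e' [0..<DIM('e)]) > 0"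
    using orthonormal_basis.ex_positive_basis DIM_positive by blast
  then show ?thesis
    using orthonormal_basis.volume_form_eq[of ?V "g p" e' "DIM('e)" "\<mu> p"] \<mu> \<open>\<mu> p \<in> alt_forms ?V DIM('e)\<close>
    by auto
qed

theorem lemma2p1:
  fixes A :: "('m::{t2_space, second_countable_topology}, 'e::euclidean_space) chart set"
    and g :: "('m, 'e) metric"
    and P :: "'m \<Rightarrow> ('m, 'e) tvec list set"
    and n q l :: nat
    and Q :: "('m, 'e) multivector_field"
    and \<alpha> :: "('m, 'e) form_field"
  assumes "oriented_riemannian_manifold A g P"
    and "n = DIM('e)"
    and "Q \<in> multivector_fields A q"
    and "\<alpha> \<in> differential_forms A l"
  shows
    "(hodge_star A g P (l - q) (contract_field A q Q \<alpha>) =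
       (- 1) powi (int q * (int l - int q)) *\<^sub>R
         wedge_field q (n - l) (flat_field A g q Q) (hodge_star A g P l \<alpha>)) \<and>
     (hodge_star A g P (n - l - q) (contract_field A q Q (hodge_star A g P l \<alpha>)) =
       (- 1) powi (int q * (int n - int l - int q) + int l * (int n - int l)) *\<^sub>R
         wedge_field q l (flat_field A g q Q) \<alpha>) \<and>
     (contract_field A q Q \<alpha> =
       (- 1) powi ((int l - int q) * (int n - int l)) *\<^sub>R
         hodge_star A g P (q + (n - l))
           (wedge_field q (n - l) (flat_field A g q Q) (hodge_star A g P l \<alpha>))) \<and>
     (contract_field A q Q (hodge_star A g P l \<alpha>) =
       (- 1) powi (int l * int q) *\<^sub>R
         hodge_star A g P (q + l) (wedge_field q l (flat_field A g q Q) \<alpha>))"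
proof -
  let ?V = "tangent_space A"
  let ?S = "\<lambda>p. star (?V p) (g p) (P p) n" and ?F = "\<lambda>p. flat (?V p) (g p) q (Q p)"
  have pointwise:
    "?S p (l - q) (contract (?V p) q (Q p) (\<alpha> p)) =
      (- 1) powi (int q * (int l - int q)) *\<^sub>R wedge q (n - l) (?F p) (?S p l (\<alpha> p))"
    "?S p (n - l - q) (contract (?V p) q (Q p) (?S p l (\<alpha> p))) =
      (- 1) powi (int q * (int n - int l - int q) + int l * (int n - int l)) *\<^sub>R wedge q l (?F p) (\<alpha> p)"
    "contract (?V p) q (Q p) (\<alpha> p) = (- 1) powi ((int l - int q) * (int n - int l)) *\<^sub>R
      ?S p (q + (n - l)) (wedge q (n - l) (?F p) (?S p l (\<alpha> p)))"
    "contract (?V p) q (Q p) (?S p l (\<alpha> p)) =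
      (- 1) powi (int l * int q) *\<^sub>R ?S p (q + l) (wedge q l (?F p) (\<alpha> p))" for p
  proof -
    have Q: "Q p \<in> multivectors (?V p) q" and \<alpha>: "\<alpha> p \<in> alt_forms (?V p) l"
      using assms(3,4) by (simp_all add: multivector_fields_def differential_forms_def)
    \<comment> \<open>No smooth frame is involved: a basis at each single point suffices because the
      operations are defined without one.\<close>
    obtain e where e: "orthonormal_basis (?V p) (g p) e n"
      and vf: "volume_form (?V p) (g p) (P p) n = orthonormal_basis.vol (?V p) (g p) e n"
      using ex_oriented_orthonormal_basis[OF assms(1), of p] assms(2) by blast
    interpret orthonormal_basis "?V p" "g p" e n
      by (rule e)
    have "(- 1::real) powi (int l * int q) = (- 1) ^ (l * q)"
      by (simp add: minus_one_powi minus_one_power)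
    then show "contract (?V p) q (Q p) (?S p l (\<alpha> p)) =
        (- 1) powi (int l * int q) *\<^sub>R ?S p (q + l) (wedge q l (?F p) (\<alpha> p))"
      using contract_star[OF vf Q \<alpha>] by (simp only:)
    show "?S p (l - q) (contract (?V p) q (Q p) (\<alpha> p)) =
        (- 1) powi (int q * (int l - int q)) *\<^sub>R wedge q (n - l) (?F p) (?S p l (\<alpha> p))"
      by (rule star_contract[OF vf Q \<alpha>])
    show "?S p (n - l - q) (contract (?V p) q (Q p) (?S p l (\<alpha> p))) =
        (- 1) powi (int q * (int n - int l - int q) + int l * (int n - int l)) *\<^sub>R wedge q l (?F p) (\<alpha> p)"
      by (rule star_contract_star[OF vf Q \<alpha>])
    show "contract (?V p) q (Q p) (\<alpha> p) = (- 1) powi ((int l - int q) * (int n - int l)) *\<^sub>R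
        ?S p (q + (n - l)) (wedge q (n - l) (?F p) (?S p l (\<alpha> p)))"
      by (rule contract_eq_star[OF vf Q \<alpha>])
  qed
  show ?thesis
    \<comment> \<open>The type instance restricts the unfolding to scaling of fields over points;
      scaling of a form at one point stays as in the pointwise identities.\<close>
    unfolding hodge_star_def contract_field_def wedge_field_def flat_field_def assms(2)[symmetric]
      scaleR_fun_def[where 'a = 'm]
    by (intro conjI ext pointwise)
qed

end
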